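(* Let $n \geq 2$ be an even integer and let $k$ be an integer. Then: (a) If $k$ is odd, there exists a homogeneous polynomial map from $S^n$ to $S^n$ of Brouwer degree $k$ and algebraic degree $2|k|-1$. (b) If $k$ is even, then for each integer $r$ with $2 \leq 2r \leq n$ there exists a polynomial map from $S^n_{2r}$ to $S^n$ of Brouwer degree $k$.
   Context: A polynomial map from $X \subset \mathbb{R}^m$ to $Y \subset \mathbb{R}^s$ is the restriction to $X$ of a map $F : \mathbb{R}^m \to \mathbb{R}^s$ all of whose components are real polynomials and such that $F(X) \subset Y$. When each component of $F$ is homogeneous of degree $d$, the polynomial map from $X$ to $Y$ is called homogeneous of (algebraic) degree $d$. $S^n \subset \mathbb{R}^{n+1}$ is the unit sphere $x_1^2 + \dots + x_{n+1}^2 = 1$. For $1 \leq q \leq n$, $S^n_q \subset \mathbb{R}^{n+1}$ is the differentiable manifold, diffeomorphic to $S^n$, defined by the equation $(x_1^2 + \dots + x_q^2)^2 + x_{q+1}^2 + \dots + x_{n+1}^2 = 1$. Brouwer degree is the usual topological degree of a continuous map between closed connected oriented $n$-manifolds, where $S^n$ and $S^n_q$ are oriented as boundaries of the bounded domains they enclose in $\mathbb{R}^{n+1}$. *)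

theory Defs
  imports "HOL-Homology.Homology" "HOL-Library.Poly_Mapping"
begin

text \<open>
  As in the homology library, \<open>\<real>\<^sup>m\<close> is \<^const>\<open>Euclidean_space\<close> \<open>m\<close>, the functions
  \<open>nat \<Rightarrow> real\<close> vanishing at all indices \<open>\<ge> m\<close>. Thus the coordinate \<open>x\<^sub>i\<close>, \<open>1 \<le> i \<le> m\<close>, is \<open>x (i - 1)\<close>.
\<close>

section \<open>Polynomial maps\<close>

text \<open>A real polynomial in the indeterminates \<open>X\<^sub>0, X\<^sub>1, \<dots>\<close>: exponent vectors to coefficients.\<close>

type_synonym real_mpoly = "(nat \<Rightarrow>\<^sub>0 nat) \<Rightarrow>\<^sub>0 real"

definition mpoly_eval :: "real_mpoly \<Rightarrow> (nat \<Rightarrow> real) \<Rightarrow> real" where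
  "mpoly_eval P x =
     (\<Sum>e\<in>Poly_Mapping.keys P. Poly_Mapping.lookup P e * (\<Prod>i\<in>Poly_Mapping.keys e. x i ^ Poly_Mapping.lookup e i))"

definition mpoly_in :: "nat \<Rightarrow> real_mpoly \<Rightarrow> bool" where
  "mpoly_in m P \<longleftrightarrow> (\<forall>e\<in>Poly_Mapping.keys P. Poly_Mapping.keys e \<subseteq> {..<m})"

definition mpoly_homogeneous :: "nat \<Rightarrow> real_mpoly \<Rightarrow> bool" where
  "mpoly_homogeneous d P \<longleftrightarrow>
     (\<forall>e\<in>Poly_Mapping.keys P. (\<Sum>i\<in>Poly_Mapping.keys e. Poly_Mapping.lookup e i) = d)"

definition mpoly_tuple_eval :: "nat \<Rightarrow> (nat \<Rightarrow> real_mpoly) \<Rightarrow> (nat \<Rightarrow> real) \<Rightarrow> nat \<Rightarrow> real" where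
  "mpoly_tuple_eval s F x = (\<lambda>i. if i < s then mpoly_eval (F i) x else 0)"

definition polynomial_map ::
    "nat \<Rightarrow> (nat \<Rightarrow> real) set \<Rightarrow> nat \<Rightarrow> (nat \<Rightarrow> real) set \<Rightarrow> ((nat \<Rightarrow> real) \<Rightarrow> nat \<Rightarrow> real) \<Rightarrow> bool" where
  "polynomial_map m X s Y f \<longleftrightarrow>
     X \<subseteq> topspace (Euclidean_space m) \<and> Y \<subseteq> topspace (Euclidean_space s) \<and>
     (\<exists>F. (\<forall>i<s. mpoly_in m (F i)) \<and> (\<forall>x\<in>X. f x = mpoly_tuple_eval s F x)) \<and> f ` X \<subseteq> Y"

definition homogeneous_polynomial_map ::
    "nat \<Rightarrow> nat \<Rightarrow> (nat \<Rightarrow> real) set \<Rightarrow> nat \<Rightarrow> (nat \<Rightarrow> real) set \<Rightarrow> ((nat \<Rightarrow> real) \<Rightarrow> nat \<Rightarrow> real) \<Rightarrow> bool" where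
  "homogeneous_polynomial_map d m X s Y f \<longleftrightarrow>
     X \<subseteq> topspace (Euclidean_space m) \<and> Y \<subseteq> topspace (Euclidean_space s) \<and>
     (\<exists>F. (\<forall>i<s. mpoly_in m (F i) \<and> mpoly_homogeneous d (F i)) \<and>
          (\<forall>x\<in>X. f x = mpoly_tuple_eval s F x)) \<and> f ` X \<subseteq> Y"


section \<open>The hypersurface \<open>S\<^sup>n\<^sub>q\<close> and the enclosed domains\<close>

definition unit_ball :: "nat \<Rightarrow> (nat \<Rightarrow> real) set" where
  "unit_ball n = {x \<in> topspace (Euclidean_space (Suc n)). (\<Sum>i\<le>n. (x i)\<^sup>2) < 1}"

definition quartic_sphere :: "nat \<Rightarrow> nat \<Rightarrow> (nat \<Rightarrow> real) set" where
  "quartic_sphere n q =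
     {x \<in> topspace (Euclidean_space (Suc n)). (\<Sum>i<q. (x i)\<^sup>2)\<^sup>2 + (\<Sum>i\<in>{q..n}. (x i)\<^sup>2) = 1}"

definition quartic_ball :: "nat \<Rightarrow> nat \<Rightarrow> (nat \<Rightarrow> real) set" where
  "quartic_ball n q =
     {x \<in> topspace (Euclidean_space (Suc n)). (\<Sum>i<q. (x i)\<^sup>2)\<^sup>2 + (\<Sum>i\<in>{q..n}. (x i)\<^sup>2) < 1}"


section \<open>Brouwer degree for boundaries of bounded domains\<close>

text \<open>
  Throughout, \<open>M\<close> is the boundary of a bounded domain \<open>D\<close> in \<open>\<real>\<^sup>n\<^sup>+\<^sup>1\<close>. An orientation of \<open>\<real>\<^sup>n\<^sup>+\<^sup>1\<close> is
  a generator of \<open>H\<^bsub>n+1\<^esub>(\<real>\<^sup>n\<^sup>+\<^sup>1, \<real>\<^sup>n\<^sup>+\<^sup>1 - 0)\<close>, carried to the other points by translation.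
\<close>

definition euclidean_orientation :: "nat \<Rightarrow> (nat \<Rightarrow> real) chain set \<Rightarrow> bool" where
  "euclidean_orientation m \<omega> \<longleftrightarrow>
     (let G = relative_homology_group (int m) (Euclidean_space m) (topspace (Euclidean_space m) - {\<lambda>i. 0})
      in \<omega> \<in> carrier G \<and> subgroup_generated G {\<omega>} = G)"

text \<open>
  The fundamental class of \<open>M\<close> oriented as the boundary of \<open>D\<close> is \<open>\<partial>\<mu> \<in> H\<^sub>n(M)\<close>, where
  \<open>\<mu> \<in> H\<^bsub>n+1\<^esub>(D \<union> M, M)\<close> restricts to the orientation \<open>\<omega>\<close> at every point of \<open>D\<close>.
\<close>

definition boundary_fundamental_class ::
    "nat \<Rightarrow> (nat \<Rightarrow> real) chain set \<Rightarrow> (nat \<Rightarrow> real) set \<Rightarrow> (nat \<Rightarrow> real) set \<Rightarrow> (nat \<Rightarrow> real) chain set \<Rightarrow> bool" where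
  "boundary_fundamental_class n \<omega> D M z \<longleftrightarrow>
     (let E = Euclidean_space (Suc n); X = subtopology E (D \<union> M)
      in \<exists>\<mu> \<in> carrier (relative_homology_group (int (Suc n)) X M).
           (\<forall>p\<in>D. hom_induced (int (Suc n)) X M E (topspace E - {\<lambda>i. 0}) (\<lambda>x i. x i - p i) \<mu> = \<omega>) \<and>
           z = hom_boundary (int (Suc n)) X M \<mu>)"

text \<open>
  The Brouwer degree of \<open>f : M \<rightarrow> N\<close> is \<open>k\<close> when \<open>f\<^sub>*[M] = k [N]\<close>. Both fundamental classes are
  taken with respect to the same \<open>\<omega>\<close>; replacing \<open>\<omega>\<close> by its inverse inverts both.
\<close>

definition has_Brouwer_degree ::
    "nat \<Rightarrow> (nat \<Rightarrow> real) set \<Rightarrow> (nat \<Rightarrow> real) set \<Rightarrow> (nat \<Rightarrow> real) set \<Rightarrow> (nat \<Rightarrow> real) set \<Rightarrow>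
      ((nat \<Rightarrow> real) \<Rightarrow> nat \<Rightarrow> real) \<Rightarrow> int \<Rightarrow> bool" where
  "has_Brouwer_degree n D M D' N f k \<longleftrightarrow>
     (let X = subtopology (Euclidean_space (Suc n)) M; Y = subtopology (Euclidean_space (Suc n)) N
      in continuous_map X Y f \<and>
         (\<exists>\<omega> z z'. euclidean_orientation (Suc n) \<omega> \<and>
            boundary_fundamental_class n \<omega> D M z \<and> boundary_fundamental_class n \<omega> D' N z' \<and>
            hom_induced (int n) X {} Y {} f z = z' [^]\<^bsub>homology_group (int n) Y\<^esub> k))"

end

theory Submission
  imports Defs "HOL-Computational_Algebra.Fundamental_Theorem_Algebra"
begin

text \<open>
  Let \<open>q = 2 r\<close> and write \<open>x = (z, y)\<close> with \<open>z \<in> \<real>\<^sup>q\<close>; \<open>q = 2\<close> in part (a). The maps are joins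
  \<open>(z, y) \<mapsto> ((p + i s) \<phi>(z), g y)\<close>, where \<open>i\<close> is a complex structure on \<open>\<real>\<^sup>q\<close>, \<open>p\<close>, \<open>s\<close>, \<open>g\<close> are polynomials
  in \<open>|z|\<^sup>2\<close> and \<open>|y|\<^sup>2\<close>, and \<open>\<phi>(t, z') = (Re (t + |z'| I)\<^sup>K, z' Im (t + |z'| I)\<^sup>K / |z'|)\<close> is the \<open>K\<close>-th power map,
  of norm \<open>|z|\<^sup>K\<close> and of degree \<open>K\<close> because \<open>S\<^sup>q\<^sup>-\<^sup>1\<close> is odd-dimensional. Such a join preserves the
  hemispheres of each coordinate of \<open>y\<close>, so its degree is that of its restriction to \<open>S\<^sup>q\<^sup>-\<^sup>1\<close>, namely \<open>K\<close>.

  It remains to make the image lie on the sphere. Let \<open>T(t) = t g(t\<^sup>2)\<close> be the odd polynomial with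
  \<open>T' = c (1 - t\<^sup>2)\<^sup>m\<^sup>-\<^sup>1\<close> and \<open>T(1) = 1\<close>. Then \<open>1 - T(t)\<^sup>2 = (1 - t\<^sup>2)\<^sup>m v(t\<^sup>2)\<close> with \<open>v > 0\<close> on \<open>{..1}\<close>,
  and on all of \<open>\<real>\<close> when \<open>m\<close> is odd. In (a), \<open>K = m\<close> and \<open>v = p\<^sup>2 + s\<^sup>2\<close>; everything is made homogeneous
  by powers of \<open>|x|\<^sup>2\<close>. In (b), \<open>K = 2 m\<close> and \<open>|z|\<^sup>4 = 1 - |y|\<^sup>2\<close> on \<open>S\<^sup>n\<^sub>q\<close>, so it suffices to write
  \<open>v(1 - u\<^sup>2)\<close>, positive for every real \<open>u\<close>, as \<open>p(u)\<^sup>2 + s(u)\<^sup>2\<close>.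
\<close>

section \<open>Degree computations on spheres\<close>

lemma Euclidean_space_eu: "Euclidean_space m = top_of_set {x. \<forall>i\<ge>m. x i = 0}"
  by (simp add: Euclidean_space_def euclidean_product_topology)

lemma nsphere_eu: "nsphere n = top_of_set (topspace (nsphere n))"
  by (simp add: nsphere euclidean_product_topology)

lemma topspace_nsphere: "topspace (nsphere n) = {x. (\<Sum>i\<le>n. (x i)\<^sup>2) = 1 \<and> (\<forall>i>n. x i = 0)}"
  by (simp add: nsphere)

lemma continuous_map_nsphere_iff:
  "continuous_map (nsphere n) (nsphere m) f \<longleftrightarrow>
     continuous_on (topspace (nsphere n)) f \<and> f \<in> topspace (nsphere n) \<rightarrow> topspace (nsphere m)"
  by (metis continuous_map_subtopology_eu nsphere_eu)

lemma continuous_on_apply: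
  fixes f :: "'a::topological_space \<Rightarrow> 'b \<Rightarrow> 'c::topological_space"
  assumes "continuous_on S f"
  shows "continuous_on S (\<lambda>x. f x i)"
  using continuous_on_compose2[OF continuous_on_product_coordinates assms] by simp

text \<open>Dividing by the norm turns a homotopy through nowhere vanishing maps into a homotopy on
  the sphere, and leaves both ends alone because they already have norm 1. Later homotopies, mostly
  linear interpolations, therefore only have to avoid the origin.\<close>

lemma Brouwer_degree2_homotopic_normalize:
  fixes H :: "real \<Rightarrow> (nat \<Rightarrow> real) \<Rightarrow> nat \<Rightarrow> real"
  assumes cont: "continuous_on ({0..1} \<times> topspace (nsphere n)) (\<lambda>(t, x). H t x)"
    and tail: "\<And>t x i. \<lbrakk>t \<in> {0..1}; x \<in> topspace (nsphere n); i > n\<rbrakk> \<Longrightarrow> H t x i = 0"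
    and nz: "\<And>t x. \<lbrakk>t \<in> {0..1}; x \<in> topspace (nsphere n)\<rbrakk> \<Longrightarrow> (\<Sum>i\<le>n. (H t x i)\<^sup>2) \<noteq> 0"
    and f: "\<And>x. x \<in> topspace (nsphere n) \<Longrightarrow> f x \<in> topspace (nsphere n) \<and> f x = H 0 x"
    and g: "\<And>x. x \<in> topspace (nsphere n) \<Longrightarrow> g x \<in> topspace (nsphere n) \<and> g x = H 1 x"
  shows "Brouwer_degree2 n f = Brouwer_degree2 n g"
proof (rule Brouwer_degree2_homotopic)
  let ?S = "topspace (nsphere n)"
  define N where "N t x = sqrt (\<Sum>i\<le>n. (H t x i)\<^sup>2)" for t x
  have Npos: "N t x > 0" if "t \<in> {0..1}" "x \<in> ?S" for t x
    unfolding N_def using nz[OF that] by (simp add: order_less_le sum_nonneg)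
  define K where "K = (\<lambda>(t, x) i. H t x i / N t x)"
  have cH: "continuous_on ({0..1} \<times> ?S) (\<lambda>p. H (fst p) (snd p) i)" for i
    using continuous_on_apply[OF cont, of i] by (simp add: case_prod_unfold)
  have "continuous_on ({0..1} \<times> ?S) K"
  proof (rule continuous_on_coordinatewise_then_product)
    fix i
    have "continuous_on ({0..1} \<times> ?S) (\<lambda>p. N (fst p) (snd p))"
      unfolding N_def by (intro continuous_intros cH)
    moreover have "\<forall>p \<in> {0..1} \<times> ?S. N (fst p) (snd p) \<noteq> 0"
      using Npos by (metis SigmaE fst_conv less_irrefl snd_conv)
    ultimately have "continuous_on ({0..1} \<times> ?S) (\<lambda>p. H (fst p) (snd p) i / N (fst p) (snd p))"
      by (intro continuous_on_divide cH)
    then show "continuous_on ({0..1} \<times> ?S) (\<lambda>p. K p i)"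
      by (simp add: K_def case_prod_unfold)
  qed
  moreover have "K ` ({0..1} \<times> ?S) \<subseteq> ?S"
  proof clarify
    fix t x assume tx: "t \<in> {0..1::real}" "x \<in> ?S"
    have "(\<Sum>i\<le>n. (K (t, x) i)\<^sup>2) = (\<Sum>i\<le>n. (H t x i)\<^sup>2) / (N t x)\<^sup>2"
      by (simp add: K_def power_divide sum_divide_distrib)
    also have "\<dots> = 1"
      using nz[OF tx] unfolding N_def by (simp add: sum_nonneg)
    finally show "K (t, x) \<in> ?S"
      using tail[OF tx] by (simp add: topspace_nsphere K_def)
  qed
  ultimately have cK: "continuous_map (prod_topology (top_of_set {0..1}) (nsphere n)) (nsphere n) K"
    by (subst (1 2) nsphere_eu) (auto simp: continuous_map_subtopology_eu Pi_iff image_subset_iff)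
  have N1: "N 0 x = 1" "N 1 x = 1" if "x \<in> ?S" for x
    using f[OF that] g[OF that] by (auto simp: N_def topspace_nsphere)
  show "homotopic_with (\<lambda>x. True) (nsphere n) (nsphere n) f g"
    unfolding homotopic_with
  proof (subst homotopic_with, simp, intro exI conjI ballI)
    show "continuous_map (prod_topology (top_of_set {0..1}) (nsphere n)) (nsphere n) K" by (rule cK)
  qed (use f g N1 in \<open>auto simp: K_def\<close>)
qed

text \<open>Every class of \<open>H\<^sub>n(S\<^sup>n, E)\<close> is a sum of classes of the two hemispheres bounded by \<open>E\<close>;
  on each of them one of the three maps is constant, hence trivial relative to \<open>{c}\<close>.\<close>

lemma Brouwer_degree2_add:
  assumes f: "continuous_map (nsphere n) (nsphere n) f"
    and g: "continuous_map (nsphere n) (nsphere n) g"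
    and h: "continuous_map (nsphere n) (nsphere n) h"
    and up: "\<And>x. \<lbrakk>x \<in> topspace (nsphere n); 0 \<le> x 0\<rbrakk> \<Longrightarrow> f x = g x \<and> h x = c"
    and lo: "\<And>x. \<lbrakk>x \<in> topspace (nsphere n); x 0 \<le> 0\<rbrakk> \<Longrightarrow> f x = h x \<and> g x = c"
    and c: "c \<in> topspace (nsphere n)"
  shows "Brouwer_degree2 n f = Brouwer_degree2 n g + Brouwer_degree2 n h"
proof (rule Brouwer_degree2_unique[OF f])
  fix z
  let ?X = "nsphere n"
  let ?G = "reduced_homology_group n ?X"
  let ?U = "subtopology ?X {x. 0 \<le> x 0}" and ?L = "subtopology ?X {x. x 0 \<le> 0}" and ?E = "{x::nat\<Rightarrow>real. x 0 = 0}"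
  let ?R = "relative_homology_group n ?X"
  let ?iL = "hom_induced n ?L ?E ?X ?E id" and ?iU = "hom_induced n ?U ?E ?X ?E id"
  assume z: "z \<in> carrier ?G"
  then have zH: "z \<in> carrier (homology_group n ?X)"
    using carrier_reduced_homology_group_subset by blast
  \<comment> \<open>By excision, each hemisphere relative to the equator has the homology of the
    sphere relative to the opposite hemisphere. These isomorphisms split the two exact sequences of
    triples and give the direct sum.\<close>
  have sumiso: "(\<lambda>(x, y). ?iL x \<otimes>\<^bsub>?R ?E\<^esub> ?iU y)
        \<in> Group.iso (relative_homology_group n ?L ?E \<times>\<times> relative_homology_group n ?U ?E) (?R ?E)"
  proof (rule conjunct1 [OF exact_sequence_sum_lemma [OF abelian_relative_homology_group]])
    show "hom_induced n ?L ?E ?X {x. 0 \<le> x 0} id \<in> Group.iso (relative_homology_group n ?L ?E) (?R {x. 0 \<le> x 0})"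
      by (rule iso_relative_homology_group_lower_hemisphere)
    show "hom_induced n ?U ?E ?X {x. x 0 \<le> 0} id \<in> Group.iso (relative_homology_group n ?U ?E) (?R {x. x 0 \<le> 0})"
      by (rule iso_relative_homology_group_upper_hemisphere)
    show "exact_seq ([?R {x. x 0 \<le> 0}, ?R ?E, relative_homology_group n ?L ?E],
          [hom_induced n ?X ?E ?X {x. x 0 \<le> 0} id, ?iL])"
      by (rule homology_exactness_triple_3) force
    show "exact_seq ([?R {x. 0 \<le> x 0}, ?R ?E, relative_homology_group n ?U ?E],
          [hom_induced n ?X ?E ?X {x. 0 \<le> x 0} id, ?iU])"
      by (rule homology_exactness_triple_3) force
  qed (auto simp: hom_induced_compose' Pi_iff)
  define w where "w = hom_induced n ?X {} ?X ?E id z"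
  have wc: "w \<in> carrier (?R ?E)"
    by (simp add: w_def hom_induced_carrier)
  have sb: "carrier (?R ?E) \<subseteq> (\<lambda>(x, y). ?iL x \<otimes>\<^bsub>?R ?E\<^esub> ?iU y)
        ` carrier (relative_homology_group n ?L ?E \<times>\<times> relative_homology_group n ?U ?E)"
    using sumiso by (simp add: iso_iff)
  obtain l u where l: "l \<in> carrier (relative_homology_group n ?L ?E)"
    and u: "u \<in> carrier (relative_homology_group n ?U ?E)" and w: "w = ?iL l \<otimes>\<^bsub>?R ?E\<^esub> ?iU u"
    using subsetD[OF sb wc] by auto
  let ?C = "?R {c}"
  interpret C: comm_group ?C by simp
  let ?r = "\<lambda>k. hom_induced n ?X ?E ?X {c} k"
  have rhom: "group_hom (?R ?E) ?C (?r k)" for k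
    by (simp add: group_hom_def group_hom_axioms_def hom_induced_hom)
  have eqc: "x 0 = 0 \<Longrightarrow> x \<in> topspace ?X \<Longrightarrow> f x = c \<and> g x = c \<and> h x = c" for x
    using up[of x] lo[of x] by auto
  have rw: "?r k w = ?r k (?iL l) \<otimes>\<^bsub>?C\<^esub> ?r k (?iU u)" for k
    unfolding w by (intro group_hom.hom_mult[OF rhom] hom_induced_carrier)
  have resL: "?r k (?iL y) = hom_induced n ?L ?E ?X {c} k y"
    and resU: "?r k (?iU y) = hom_induced n ?U ?E ?X {c} k y"
    if "continuous_map ?X ?X k" "\<And>x. x 0 = 0 \<Longrightarrow> x \<in> topspace ?X \<Longrightarrow> k x = c" for k y
  proof -
    \<comment> \<open>The map \<open>k\<close> is known to send to \<open>c\<close> only those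
      points of \<open>?E\<close> that lie on the sphere. Cutting the subspaces down to the topspace
      makes it a map of pairs, so that the composition rule applies.\<close>
    have E: "hom_induced n ?X ?E ?X {c} k = hom_induced n ?X (topspace ?X \<inter> ?E) ?X (topspace ?X \<inter> {c}) k"
            "hom_induced n Y ?E ?X {c} k = hom_induced n Y (topspace Y \<inter> ?E) ?X (topspace ?X \<inter> {c}) k" for Y :: "(nat\<Rightarrow>real) topology"
      by simp_all
    have i: "hom_induced n Y ?E ?X ?E id = hom_induced n Y (topspace Y \<inter> ?E) ?X (topspace ?X \<inter> ?E) id" for Y
      by simp
    show "?r k (?iL y) = hom_induced n ?L ?E ?X {c} k y"
      unfolding E i using that c
      by (subst hom_induced_compose') (auto simp del: hom_induced_restrict)
    show "?r k (?iU y) = hom_induced n ?U ?E ?X {c} k y"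
      unfolding E i using that c
      by (subst hom_induced_compose') (auto simp del: hom_induced_restrict)
  qed
  \<comment> \<open>A constant map factors through the pair \<open>({c}, {c})\<close>, whose
    relative homology is trivial.\<close>
  have const: "hom_induced n Y ?E ?X {c} k y = \<one>\<^bsub>?C\<^esub>"
    if "\<And>x. x \<in> topspace Y \<Longrightarrow> k x = c" for k y and Y :: "(nat\<Rightarrow>real) topology"
  proof -
    have "hom_induced n Y ?E ?X {c} k y = hom_induced n Y ?E ?X {c} (id \<circ> (\<lambda>x. c)) y"
      using that by (metis comp_apply hom_induced_eq id_apply)
    also have "\<dots> = hom_induced n (subtopology ?X {c}) {c} ?X {c} id
                      (hom_induced n Y ?E (subtopology ?X {c}) {c} (\<lambda>x. c) y)"
      using c by (subst hom_induced_compose') auto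
    also have "hom_induced n Y ?E (subtopology ?X {c}) {c} (\<lambda>x. c) y
                 = \<one>\<^bsub>relative_homology_group n (subtopology ?X {c}) {c}\<^esub>"
    proof -
      have "topspace (subtopology ?X {c}) = {c}" using c by auto
      then show ?thesis
        by (metis hom_induced_carrier singletonD trivial_group_def trivial_relative_homology_group_topspace)
    qed
    also have "hom_induced n (subtopology ?X {c}) {c} ?X {c} id \<dots> = \<one>\<^bsub>?C\<^esub>"
      by (meson group_hom.hom_one group_hom_def group_hom_axioms_def group_relative_homology_group hom_induced_hom)
    finally show ?thesis .
  qed
  have same: "hom_induced n Y ?E ?X {c} k y = hom_induced n Y ?E ?X {c} k' y"
    if "\<And>x. x \<in> topspace Y \<Longrightarrow> k x = k' x" for k k' y and Y :: "(nat\<Rightarrow>real) topology"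
    using that by (metis hom_induced_eq)
  have "?r f w = ?r h (?iL l) \<otimes>\<^bsub>?C\<^esub> ?r g (?iU u)"
    unfolding rw using eqc by (simp add: resL resU f g h, intro arg_cong2[of _ _ _ _ "monoid.mult ?C"] same) (auto simp: up lo)
  moreover have "?r g w = ?r g (?iU u)"
    unfolding rw using eqc const[of ?L g l] lo by (simp add: resL resU g hom_induced_carrier del: one_relative_homology_group)
  moreover have "?r h w = ?r h (?iL l)"
    unfolding rw using eqc const[of ?U h u] up by (simp add: resL resU h hom_induced_carrier del: one_relative_homology_group)
  ultimately have key: "?r f w = ?r g w \<otimes>\<^bsub>?C\<^esub> ?r h w"
    by (simp add: C.m_comm hom_induced_carrier)
  \<comment> \<open>A single point is contractible, so \<open>?j\<close> is an isomorphism and the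
    relation \<open>key\<close>, found relative to \<open>{c}\<close>, lifts to reduced
    homology.\<close>
  let ?j = "hom_induced n ?X {} ?X {c} id"
  have jiso: "?j \<in> iso ?G ?C"
    using c by (intro iso_reduced_homology_by_contractible)
               (auto simp: contractible_space_subtopology_singleton)
  have jr: "?j (hom_induced n ?X {} ?X {} k z) = ?r k w"
    if "continuous_map ?X ?X k" "\<And>x. x 0 = 0 \<Longrightarrow> x \<in> topspace ?X \<Longrightarrow> k x = c" for k
  proof -
    have E: "hom_induced n ?X ?E ?X {c} k = hom_induced n ?X (topspace ?X \<inter> ?E) ?X (topspace ?X \<inter> {c}) k"
      by simp
    have i: "hom_induced n ?X {} ?X ?E id = hom_induced n ?X (topspace ?X \<inter> {}) ?X (topspace ?X \<inter> ?E) id"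
      by (simp only: hom_induced_restrict)
    have "?r k w = hom_induced n ?X (topspace ?X \<inter> {}) ?X (topspace ?X \<inter> {c}) k z"
      unfolding w_def E i using that c
      by (subst hom_induced_compose') (auto simp del: hom_induced_restrict)
    moreover have "?j (hom_induced n ?X {} ?X {} k z) = hom_induced n ?X {} ?X {c} k z"
      using that by (subst hom_induced_compose') auto
    ultimately show ?thesis by (simp only: hom_induced_restrict)
  qed
  interpret G: group ?G by simp
  let ?h = "\<lambda>k. hom_induced n ?X {} ?X {} k z"
  have hG: "?h k \<in> carrier ?G" for k
    using z by (rule hom_induced_reduced)
  have "?j (?h f) = ?j (?h g \<otimes>\<^bsub>?G\<^esub> ?h h)"
    using key jr f g h eqc hG hom_mult[OF iso_imp_homomorphism[OF jiso]] by simp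
  then have "?h f = ?h g \<otimes>\<^bsub>?G\<^esub> ?h h"
    using jiso hG by (meson G.m_closed inj_onD iso_iff)
  then show "?h f = z [^]\<^bsub>?G\<^esub> (Brouwer_degree2 n g + Brouwer_degree2 n h)"
    using z by (simp add: Brouwer_degree2 G.int_pow_mult)
qed

text \<open>A map that preserves both hemispheres acts compatibly on the chain of isomorphisms from
  the sphere to the sphere relative to the lower hemisphere, then by excision to the upper
  hemisphere relative to the equator, and by the connecting homomorphism to the equator. The
  exponent of the action is thus the same at both ends.\<close>

lemma Brouwer_degree2_suspension:
  assumes F: "continuous_map (nsphere (Suc n)) (nsphere (Suc n)) F"
    and up: "\<And>x. \<lbrakk>x \<in> topspace (nsphere (Suc n)); 0 \<le> x (Suc n)\<rbrakk> \<Longrightarrow> 0 \<le> F x (Suc n)"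
    and lo: "\<And>x. \<lbrakk>x \<in> topspace (nsphere (Suc n)); x (Suc n) \<le> 0\<rbrakk> \<Longrightarrow> F x (Suc n) \<le> 0"
  shows "Brouwer_degree2 (Suc n) F = Brouwer_degree2 n F"
proof -
  \<comment> \<open>The relative groups refer to half-spaces of the whole function space, whereas
    \<open>F\<close> is controlled only on the sphere. Extending by the identity makes the
    hemisphere conditions hold everywhere.\<close>
  define r where "r = (\<lambda>x. if x \<in> topspace (nsphere (Suc n)) then F x else x)"
  have sub: "topspace (nsphere n) = topspace (nsphere (Suc n)) \<inter> {x. x (Suc n) = 0}"
    by (metis subtopology_nsphere_equator topspace_subtopology)
  have rF: "Brouwer_degree2 (Suc n) F = Brouwer_degree2 (Suc n) r" "Brouwer_degree2 n F = Brouwer_degree2 n r"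
    using sub by (auto simp: r_def intro!: Brouwer_degree2_eq)
  have rsub: "r \<in> {x. 0 \<le> x (Suc n)} \<rightarrow> {x. 0 \<le> x (Suc n)}" 
             "r \<in> {x. x (Suc n) \<le> 0} \<rightarrow> {x. x (Suc n) \<le> 0}" 
             "r \<in> {x. x (Suc n) = 0} \<rightarrow> {x. x (Suc n) = 0}"
    using up lo by (auto simp: r_def intro: antisym)
  have cmr: "continuous_map (nsphere (Suc n)) (nsphere (Suc n)) r"
    using F by (rule continuous_map_eq) (simp add: r_def)
  let ?X = "nsphere (Suc n)" and ?q = "1 + int n"
  let ?U = "{x::nat\<Rightarrow>real. 0 \<le> x (Suc n)}" and ?L = "{x::nat\<Rightarrow>real. x (Suc n) \<le> 0}" and ?E = "{x::nat\<Rightarrow>real. x (Suc n) = 0}"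
  let ?Y = "subtopology ?X ?U"
  let ?H = "reduced_homology_group (int n) (nsphere n)" and ?K = "reduced_homology_group ?q ?X"
  let ?A = "relative_homology_group ?q ?Y ?E" and ?B = "relative_homology_group ?q ?X ?L"
  let ?b = "hom_boundary ?q ?Y ?E"
  let ?e = "hom_induced ?q ?Y ?E ?X ?L id" and ?j = "hom_induced ?q ?X {} ?X ?L id"
  let ?rH = "hom_induced (int n) (nsphere n) {} (nsphere n) {} r" and ?rK = "hom_induced ?q ?X {} ?X {} r"
  let ?rA = "hom_induced ?q ?Y ?E ?Y ?E r"
  have b: "?b \<in> iso ?A ?H"
    by (rule iso_upper_hemisphere_reduced_homology_group)
  have e: "?e \<in> iso ?A ?B"
    by (rule iso_relative_homology_group_upper_hemisphere)
  have j: "?j \<in> iso ?K ?B"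
    by (rule iso_reduced_homology_group_lower_hemisphere) simp
  have cY: "continuous_map ?Y ?Y r"
    using continuous_map_from_subtopology[OF cmr] rsub(1) by (auto simp: continuous_map_in_subtopology)
  have YE: "subtopology ?Y ?E = nsphere n"
  proof -
    have "?U \<inter> ?E = ?E" by auto
    then show ?thesis by (simp add: subtopology_subtopology subtopology_nsphere_equator)
  qed
  interpret H: group ?H by simp
  interpret A: group ?A by simp
  interpret B: group ?B by simp
  interpret K: group ?K by simp
  interpret b: group_hom ?A ?H ?b using b by (simp add: group_hom_def group_hom_axioms_def iso_imp_homomorphism)
  interpret e: group_hom ?A ?B ?e using e by (simp add: group_hom_def group_hom_axioms_def iso_imp_homomorphism)
  interpret j: group_hom ?K ?B ?j using j by (simp add: group_hom_def group_hom_axioms_def iso_imp_homomorphism)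
  let ?d = "Brouwer_degree2 n r"
  have "?rK z = z [^]\<^bsub>?K\<^esub> ?d" if z: "z \<in> carrier ?K" for z
  proof -
    have "?j z \<in> ?e ` carrier ?A"
      using j.hom_closed[OF z] e by (simp add: iso_def bij_betw_def)
    then obtain a where a: "a \<in> carrier ?A" and ja: "?j z = ?e a" by blast
    have "?b (?rA a) = ?rH (?b a)"
      using naturality_hom_induced[OF cY rsub(3), of ?q] unfolding YE by (simp add: fun_eq_iff)
    also have "\<dots> = ?b (a [^]\<^bsub>?A\<^esub> ?d)"
      using Brouwer_degree2[OF b.hom_closed[OF a]] b.hom_int_pow[OF a] by simp
    finally have rA: "?rA a = a [^]\<^bsub>?A\<^esub> ?d"
    proof (rule inj_onD[rotated])
      show "inj_on ?b (carrier ?A)"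
        using b by (simp add: iso_def bij_betw_def)
    qed (use a A.int_pow_closed hom_induced_carrier in blast)+
    have "?j (?rK z) = hom_induced ?q ?X {} ?X ?L r z"
      using cmr by (subst hom_induced_compose') auto
    also have "\<dots> = hom_induced ?q ?X ?L ?X ?L r (?j z)"
      using cmr rsub(2) by (subst hom_induced_compose') auto
    also have "\<dots> = hom_induced ?q ?Y ?E ?X ?L r a"
      unfolding ja using cmr rsub(2) by (subst hom_induced_compose') auto
    also have "\<dots> = ?e (?rA a)"
      using cY rsub(3) by (subst hom_induced_compose') auto
    also have "\<dots> = ?j (z [^]\<^bsub>?K\<^esub> ?d)"
      using ja by (simp only: rA e.hom_int_pow[OF a] j.hom_int_pow[OF z])
    finally show ?thesis
    proof (rule inj_onD[rotated])
      show "inj_on ?j (carrier ?K)"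
        using j by (simp add: iso_def bij_betw_def)
    qed (use z K.int_pow_closed hom_induced_reduced in blast)+
  qed
  then have "hom_induced (int (Suc n)) ?X {} ?X {} r z = z [^]\<^bsub>reduced_homology_group (int (Suc n)) ?X\<^esub> ?d"
    if "z \<in> carrier (reduced_homology_group (int (Suc n)) ?X)" for z
    using that by (simp only: of_nat_Suc)
  then show ?thesis
    unfolding rF by (rule Brouwer_degree2_unique[OF cmr])
qed

section \<open>Fundamental classes of boundaries\<close>

lemma continuous_on_coordinate: "continuous_on S (\<lambda>x. x i)"
  by (rule continuous_on_apply[OF continuous_on_id])

lemma continuous_on_snd_coordinate:
  assumes "continuous_on S f"
  shows "continuous_on (T \<times> S) (\<lambda>p. f (snd p) i)"
proof (rule continuous_on_apply)
  show "continuous_on (T \<times> S) (\<lambda>p. f (snd p))"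
    by (rule continuous_on_compose2[OF assms continuous_on_snd[OF continuous_on_id]]) auto
qed

lemma continuous_on_snd_apply: "continuous_on S (\<lambda>p. snd p i)"
  by (rule continuous_on_apply[OF continuous_on_snd[OF continuous_on_id]])

lemma continuous_map_id_top_of_set: "S \<subseteq> T \<Longrightarrow> continuous_map (top_of_set S) (top_of_set T) id"
  by (auto simp: continuous_map_subtopology_eu)

section \<open>The closed ball, the punctured space and the local orientation at the origin\<close>

definition closed_unit_ball :: "nat \<Rightarrow> (nat \<Rightarrow> real) set" where
  "closed_unit_ball n = unit_ball n \<union> topspace (nsphere n)"

lemma closed_unit_ball: "closed_unit_ball n = {x. (\<Sum>i\<le>n. (x i)\<^sup>2) \<le> 1 \<and> (\<forall>i>n. x i = 0)}"
  by (auto simp: closed_unit_ball_def unit_ball_def topspace_nsphere topspace_Euclidean_space Suc_le_eq)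

lemma subtopology_Euclidean_eu:
  assumes "S \<subseteq> topspace (Euclidean_space m)"
  shows "subtopology (Euclidean_space m) S = top_of_set S"
proof -
  have "{x. \<forall>i\<ge>m. x i = 0} \<inter> S = S"
    using assms by (auto simp: topspace_Euclidean_space)
  then show ?thesis
    by (simp add: Euclidean_space_eu subtopology_subtopology)
qed

lemma closed_unit_ball_subset: "closed_unit_ball n \<subseteq> topspace (Euclidean_space (Suc n))"
  and nsphere_subset: "topspace (nsphere n) \<subseteq> topspace (Euclidean_space (Suc n))"
  by (auto simp: closed_unit_ball topspace_nsphere topspace_Euclidean_space)

lemma subtopology_Euclidean_nsphere: "subtopology (Euclidean_space (Suc n)) (topspace (nsphere n)) = nsphere n"
  by (simp add: subtopology_Euclidean_eu nsphere_subset flip: nsphere_eu)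

lemma contractible_closed_unit_ball: "contractible_space (top_of_set (closed_unit_ball n))"
proof -
  let ?H = "\<lambda>(t, x) i. (1 - t) * x i :: real"
  have "continuous_on ({0..1} \<times> closed_unit_ball n) ?H"
  proof (rule continuous_on_coordinatewise_then_product)
    fix i
    have "continuous_on ({0..1} \<times> closed_unit_ball n) (\<lambda>p. (1 - fst p) * snd p i)"
      by (intro continuous_intros continuous_on_coordinate continuous_on_snd_apply)
    then show "continuous_on ({0..1} \<times> closed_unit_ball n) (\<lambda>p. ?H p i)"
      by (simp add: case_prod_unfold)
  qed
  moreover have "?H \<in> {0..1} \<times> closed_unit_ball n \<rightarrow> closed_unit_ball n"
  proof clarify
    fix t x assume t: "t \<in> {0..1::real}" and x: "x \<in> closed_unit_ball n"
    have "(\<Sum>i\<le>n. ((1 - t) * x i)\<^sup>2) = (1 - t)\<^sup>2 * (\<Sum>i\<le>n. (x i)\<^sup>2)"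
      by (simp add: power_mult_distrib sum_distrib_left)
    also have "\<dots> \<le> 1 * 1"
      using t x by (intro mult_mono) (auto simp: closed_unit_ball sum_nonneg power_le_one)
    finally show "(\<lambda>i. (1 - t) * x i) \<in> closed_unit_ball n"
      using x by (simp add: closed_unit_ball)
  qed
  ultimately show ?thesis
    unfolding contractible_space_def homotopic_with_def
    by (intro exI[of _ "\<lambda>i. 0"] exI[of _ ?H]) (auto simp: continuous_map_subtopology_eu)
qed

abbreviation punctured_space :: "nat \<Rightarrow> (nat \<Rightarrow> real) set" where
  "punctured_space m \<equiv> topspace (Euclidean_space m) - {\<lambda>i. 0}"

lemma punctured_norm_pos:
  assumes "x \<in> punctured_space (Suc n)"
  shows "(\<Sum>i\<le>n. (x i)\<^sup>2) > 0"
proof -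
  obtain j where "x j \<noteq> 0" "j \<le> n"
    using assms by (force simp: topspace_Euclidean_space fun_eq_iff not_less_eq_eq)
  then have "0 < (x j)\<^sup>2" "(x j)\<^sup>2 \<le> (\<Sum>i\<le>n. (x i)\<^sup>2)"
    by (auto intro!: member_le_sum)
  then show ?thesis by linarith
qed

lemma nsphere_subset_punctured: "topspace (nsphere n) \<subseteq> punctured_space (Suc n)"
  by (auto simp: topspace_nsphere topspace_Euclidean_space)

text \<open>Radial projection is a homotopy inverse of the inclusion; the straight segment from a
  nonzero point to its projection stays on an open ray.\<close>

lemma iso_nsphere_punctured:
  "hom_induced p (nsphere n) {} (subtopology (Euclidean_space (Suc n)) (punctured_space (Suc n))) {} id
     \<in> iso (reduced_homology_group p (nsphere n))
           (reduced_homology_group p (subtopology (Euclidean_space (Suc n)) (punctured_space (Suc n))))"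
proof -
  let ?P = "punctured_space (Suc n)" and ?S = "topspace (nsphere n)"
  define N where "N x = sqrt (\<Sum>i\<le>n. (x i)\<^sup>2)" for x :: "nat \<Rightarrow> real"
  define g where "g = (\<lambda>x i. x i / N x)"
  have eq: "subtopology (Euclidean_space (Suc n)) ?P = top_of_set ?P"
    by (intro subtopology_Euclidean_eu) auto
  have Npos: "N x > 0" if "x \<in> ?P" for x
    using punctured_norm_pos[OF that] by (simp add: N_def)
  have cN: "continuous_on U N" for U
    unfolding N_def by (intro continuous_intros continuous_on_coordinate continuous_on_snd_apply)
  have gS: "g x \<in> ?S" if "x \<in> ?P" for x
  proof -
    have "(\<Sum>i\<le>n. (g x i)\<^sup>2) = (\<Sum>i\<le>n. (x i)\<^sup>2) / (N x)\<^sup>2"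
      by (simp add: g_def power_divide sum_divide_distrib)
    also have "(N x)\<^sup>2 = (\<Sum>i\<le>n. (x i)\<^sup>2)"
      by (simp add: N_def sum_nonneg)
    finally show ?thesis
      using that punctured_norm_pos[OF that] by (simp add: topspace_nsphere g_def topspace_Euclidean_space)
  qed
  have gid: "g x = x" if "x \<in> ?S" for x
    using that by (simp add: g_def N_def topspace_nsphere)
  have cg: "continuous_on ?P g"
    unfolding g_def
  proof (intro continuous_on_coordinatewise_then_product continuous_on_divide cN)
    show "\<forall>x\<in>?P. N x \<noteq> 0" using Npos by (metis less_irrefl)
  qed (rule continuous_on_coordinate)
  have "continuous_map (nsphere n) (top_of_set ?P) id"
    using continuous_map_id_top_of_set[OF nsphere_subset_punctured[of n]] by (simp flip: nsphere_eu)
  moreover have "continuous_map (top_of_set ?P) (nsphere n) g"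
    by (subst nsphere_eu) (use cg gS in \<open>auto simp: continuous_map_subtopology_eu\<close>)
  moreover have "homotopic_with (\<lambda>h. True) (nsphere n) (nsphere n) (g \<circ> id) id"
    using gid by (intro homotopic_with_equal
        continuous_map_compose[OF \<open>continuous_map (nsphere n) _ id\<close> \<open>continuous_map _ (nsphere n) g\<close>]) auto
  moreover have "homotopic_with (\<lambda>k. True) (top_of_set ?P) (top_of_set ?P) (id \<circ> g) id"
  proof -
    let ?H = "\<lambda>(t, x) i. (1 - t) * g x i + t * x i :: real"
    have "continuous_on ({0..1} \<times> ?P) ?H"
    proof (rule continuous_on_coordinatewise_then_product)
      fix i
      have "continuous_on ({0..1} \<times> ?P) (\<lambda>p. g (snd p) i)"
        by (rule continuous_on_snd_coordinate[OF cg])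
      then have "continuous_on ({0..1} \<times> ?P) (\<lambda>p. (1 - fst p) * g (snd p) i + fst p * snd p i)"
        by (intro continuous_intros continuous_on_coordinate continuous_on_snd_apply)
      then show "continuous_on ({0..1} \<times> ?P) (\<lambda>p. ?H p i)"
        by (simp add: case_prod_unfold)
    qed
    moreover have "(\<lambda>i. (1 - t) * g x i + t * x i) \<in> ?P" if t: "t \<in> {0..1::real}" and x: "x \<in> ?P" for t x
    proof -
      have N: "N x > 0" using Npos x by simp
      obtain j where "x j \<noteq> 0" using x by auto
      have "(1 - t) * (x j / N x) + t * x j = ((1 - t) / N x + t) * x j"
        by (simp add: algebra_simps)
      moreover have "(1 - t) / N x + t > 0"
        using t N by (cases "t = 0") (auto intro: add_nonneg_pos)
      ultimately have "(1 - t) * g x j + t * x j \<noteq> 0"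
        using \<open>x j \<noteq> 0\<close> by (simp add: g_def)
      then have "(\<lambda>i. (1 - t) * g x i + t * x i) \<noteq> (\<lambda>i. 0)" by metis
      then show ?thesis
        using x by (simp add: topspace_Euclidean_space g_def)
    qed
    then have "?H \<in> {0..1} \<times> ?P \<rightarrow> ?P"
      by (simp only: Pi_iff mem_Times_iff case_prod_unfold) simp
    ultimately show ?thesis
      unfolding homotopic_with_def
      by (intro exI[of _ ?H]) (auto simp: continuous_map_subtopology_eu)
  qed
  ultimately show ?thesis
    unfolding eq by (rule homotopy_equivalence_reduced_homology_group_isomorphism)
qed

lemma int_Suc_minus1: "int (Suc n) - 1 = int n" by simp

text \<open>The ball and the Euclidean space are contractible, so both connecting homomorphisms are
  isomorphisms. Choose \<mu> whose boundary generates the homology of the sphere; by naturality and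
  \<open>iso_nsphere_punctured\<close> its image generates the local homology at the origin.\<close>

lemma euclidean_orientation_exists:
  assumes "n \<ge> 1"
  obtains \<mu> where
    "\<mu> \<in> carrier (relative_homology_group (int (Suc n)) (top_of_set (closed_unit_ball n)) (topspace (nsphere n)))"
    "euclidean_orientation (Suc n)
       (hom_induced (int (Suc n)) (top_of_set (closed_unit_ball n)) (topspace (nsphere n))
          (Euclidean_space (Suc n)) (punctured_space (Suc n)) id \<mu>)"
proof -
  let ?q = "int (Suc n)"
  let ?B = "top_of_set (closed_unit_ball n)" and ?S = "topspace (nsphere n)"
  let ?E = "Euclidean_space (Suc n)" and ?P = "punctured_space (Suc n)"
  let ?G = "relative_homology_group ?q ?E ?P"
  let ?GB = "relative_homology_group ?q ?B ?S"
  let ?H = "reduced_homology_group (int n) (nsphere n)"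
  let ?H' = "reduced_homology_group (int n) (subtopology ?E ?P)"
  have SB: "?S \<subseteq> closed_unit_ball n" by (auto simp: closed_unit_ball_def)
  have subS: "subtopology ?B ?S = nsphere n"
    using SB by (subst (2) nsphere_eu) (simp add: subtopology_subtopology Int_absorb1)
  have ne: "?S \<noteq> {}" using in_topspace_nsphere by blast
  have b0: "hom_boundary ?q ?B ?S \<in> iso ?GB ?H"
  proof -
    have "topspace ?B \<inter> ?S = ?S" using SB by auto
    with ne have "topspace ?B \<inter> ?S \<noteq> {}" by metis
    from iso_relative_homology_of_contractible[OF contractible_closed_unit_ball this, of ?q]
    show ?thesis unfolding subS int_Suc_minus1 .
  qed
  have b1: "hom_boundary ?q ?E ?P \<in> iso ?G ?H'"
  proof -
    have "topspace ?E \<inter> ?P \<noteq> {}" using ne nsphere_subset_punctured by fastforce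
    then show ?thesis
      using iso_relative_homology_of_contractible[OF contractible_Euclidean_space, of "Suc n" ?P ?q]
      unfolding int_Suc_minus1 by simp
  qed
  obtain z where z: "z \<in> carrier ?H" and zgen: "subgroup_generated ?H {z} = ?H"
    using cyclic_reduced_homology_group_nsphere [of n n] by (auto simp: cyclic_group_def)
  have "z \<in> hom_boundary ?q ?B ?S ` carrier ?GB"
    using b0 z by (simp add: iso_def bij_betw_def)
  then obtain \<mu> where mu: "\<mu> \<in> carrier ?GB" and zmu: "hom_boundary ?q ?B ?S \<mu> = z"
    by blast
  let ?i = "hom_induced ?q ?B ?S ?E ?P id"
  define \<omega> where "\<omega> = ?i \<mu>"
  have om: "\<omega> \<in> carrier ?G" by (simp add: \<omega>_def hom_induced_carrier)
  interpret G: group ?G by simp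
  interpret H: group ?H by simp
  interpret H': group ?H' by simp
  let ?k = "hom_induced (int n) (nsphere n) {} (subtopology ?E ?P) {} id"
  have kiso: "?k \<in> iso ?H ?H'" by (rule iso_nsphere_punctured)
  interpret k: group_hom ?H ?H' ?k
    using kiso by (simp add: group_hom_def group_hom_axioms_def iso_imp_homomorphism)
  interpret b: group_hom ?G ?H' "hom_boundary ?q ?E ?P"
    using b1 by (simp add: group_hom_def group_hom_axioms_def iso_imp_homomorphism)
  have bom: "hom_boundary ?q ?E ?P \<omega> = ?k z"
  proof -
    have cid: "continuous_map ?B ?E id"
      using closed_unit_ball_subset[of n] by (simp add: Euclidean_space_eu continuous_map_subtopology_eu)
       (auto simp: topspace_Euclidean_space)
    have "hom_boundary ?q ?E ?P \<circ> ?i = hom_induced (?q - 1) (subtopology ?B ?S) {} (subtopology ?E ?P) {} id \<circ> hom_boundary ?q ?B ?S"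
      using nsphere_subset_punctured[of n] by (intro naturality_hom_induced[OF cid]) (simp add: Pi_iff subset_iff)
    then show ?thesis
      unfolding subS int_Suc_minus1 \<omega>_def by (metis comp_apply zmu)
  qed
  have "\<exists>m::int. a = \<omega> [^]\<^bsub>?G\<^esub> m" if a: "a \<in> carrier ?G" for a
  proof -
    have "hom_boundary ?q ?E ?P a \<in> ?k ` carrier ?H"
      using a kiso b.hom_closed by (auto simp: iso_def bij_betw_def)
    then obtain y where y: "y \<in> carrier ?H" "hom_boundary ?q ?E ?P a = ?k y" by blast
    have "y \<in> carrier (subgroup_generated ?H {z})" using y zgen by simp
    then obtain m :: int where m: "y = z [^]\<^bsub>?H\<^esub> m"
      using H.carrier_subgroup_generated_by_singleton[OF z] by auto
    have "hom_boundary ?q ?E ?P a = hom_boundary ?q ?E ?P (\<omega> [^]\<^bsub>?G\<^esub> m)"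
      by (simp only: y(2) m b.hom_int_pow[OF om] k.hom_int_pow[OF z] bom)
    then have "a = \<omega> [^]\<^bsub>?G\<^esub> m"
    proof (rule inj_onD[rotated])
      show "inj_on (hom_boundary ?q ?E ?P) (carrier ?G)"
        using b1 by (simp add: iso_def bij_betw_def)
    qed (use a om G.int_pow_closed in blast)+
    then show ?thesis by blast
  qed
  then have "carrier (subgroup_generated ?G {\<omega>}) = carrier ?G"
    unfolding G.carrier_subgroup_generated_by_singleton[OF om] using G.int_pow_closed[OF om] by blast
  then have "subgroup_generated ?G {\<omega>} = ?G"
    by (intro monoid.equality) (auto simp: subgroup_generated_def)
  then have "euclidean_orientation (Suc n) \<omega>"
    using om by (simp add: euclidean_orientation_def Let_def)
  then show thesis
    using that mu unfolding \<omega>_def by blast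
qed

text \<open>The pushforward of \<mu> under \<open>h\<close> serves as the relative class. To see
  that it restricts to \<omega> at \<open>p\<close>, first shrink the translation by
  \<open>p\<close> to zero: \<open>star\<close> keeps \<open>h x\<close> off the segment from the
  origin to \<open>p\<close>. Then move \<open>h\<close> linearly to the identity, which
  \<open>dir\<close> permits. The map \<open>h\<close> need not be a homeomorphism.\<close>

lemma boundary_fundamental_class_map:
  assumes DM: "D \<subseteq> topspace (Euclidean_space (Suc n))" "M \<subseteq> topspace (Euclidean_space (Suc n))"
    and h: "continuous_on (closed_unit_ball n) h" "h \<in> closed_unit_ball n \<rightarrow> D \<union> M" "h \<in> topspace (nsphere n) \<rightarrow> M"
    and star: "\<And>p s x. \<lbrakk>p \<in> D; s \<in> {0..1}; x \<in> M\<rbrakk> \<Longrightarrow> x \<noteq> (\<lambda>i. s * p i)"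
    and dir: "\<And>s x. \<lbrakk>s \<in> {0..1}; x \<in> topspace (nsphere n)\<rbrakk> \<Longrightarrow> (\<lambda>i. (1 - s) * h x i + s * x i) \<noteq> (\<lambda>i. 0)"
    and mu: "\<mu> \<in> carrier (relative_homology_group (int (Suc n)) (top_of_set (closed_unit_ball n)) (topspace (nsphere n)))"
    and om: "\<omega> = hom_induced (int (Suc n)) (top_of_set (closed_unit_ball n)) (topspace (nsphere n))
          (Euclidean_space (Suc n)) (punctured_space (Suc n)) id \<mu>"
  shows "boundary_fundamental_class n \<omega> D M
           (hom_induced (int n) (nsphere n) {} (subtopology (Euclidean_space (Suc n)) M) {} h
              (hom_boundary (int (Suc n)) (top_of_set (closed_unit_ball n)) (topspace (nsphere n)) \<mu>))"
proof -
  let ?q = "int (Suc n)" and ?C = "closed_unit_ball n"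
  let ?B = "top_of_set (closed_unit_ball n)" and ?S = "topspace (nsphere n)"
  let ?E = "Euclidean_space (Suc n)" and ?P = "punctured_space (Suc n)"
  let ?X = "subtopology ?E (D \<union> M)"
  have SB: "?S \<subseteq> ?C" by (auto simp: closed_unit_ball_def)
  have subS: "subtopology ?B ?S = nsphere n"
    using SB by (subst (2) nsphere_eu) (simp add: subtopology_subtopology Int_absorb1)
  have X: "?X = top_of_set (D \<union> M)"
    using DM by (intro subtopology_Euclidean_eu) auto
  have cE: "continuous_map (top_of_set U) ?E k \<longleftrightarrow> continuous_on U k \<and> k \<in> U \<rightarrow> topspace ?E" for U and k :: "'c::topological_space \<Rightarrow> nat \<Rightarrow> real"
    by (simp add: Euclidean_space_eu continuous_map_subtopology_eu) 
  have ch: "continuous_map ?B ?X h"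
    using h(1,2) by (simp add: X continuous_map_subtopology_eu)
  have hE: "h x \<in> topspace ?E" if "x \<in> ?C" for x
    using that h(2) DM by blast
  have subM: "subtopology ?X M = subtopology ?E M"
    by (simp add: subtopology_subtopology Int_absorb1)
  let ?mu = "hom_induced ?q ?B ?S ?X M h \<mu>"
  have "hom_induced ?q ?X M ?E ?P (\<lambda>x i. x i - p i) ?mu = \<omega>" if p: "p \<in> D" for p
  proof -
    have pE: "p \<in> topspace ?E" using p DM by auto
    have MP: "(\<lambda>i. x i - p i) \<in> ?P" if "x \<in> M" for x
      using star[OF p, of 1 x] that DM pE by (auto simp: topspace_Euclidean_space fun_eq_iff)
    have ct: "continuous_map ?X ?E (\<lambda>x i. x i - p i)"
      unfolding X cE
    proof
      show "continuous_on (D \<union> M) (\<lambda>x i. x i - p i)"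
        by (rule continuous_on_coordinatewise_then_product) (intro continuous_on_diff continuous_on_const continuous_on_coordinate)
      show "(\<lambda>x i. x i - p i) \<in> D \<union> M \<rightarrow> topspace ?E"
        using DM pE by (auto simp: topspace_Euclidean_space subset_iff)
    qed
    have "hom_induced ?q ?X M ?E ?P (\<lambda>x i. x i - p i) ?mu = hom_induced ?q ?B ?S ?E ?P ((\<lambda>x i. x i - p i) \<circ> h) \<mu>"
      using h(3) MP by (intro hom_induced_compose' ch ct) auto
    also have "\<dots> = hom_induced ?q ?B ?S ?E ?P h \<mu>"
    proof -
      let ?H = "\<lambda>(t, x) i. h x i - (1 - t) * p i"
      have "continuous_on ({0..1} \<times> ?C) ?H"
      proof (rule continuous_on_coordinatewise_then_product)
        fix i
        have "continuous_on ({0..1} \<times> ?C) (\<lambda>x. h (snd x) i)"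
          by (rule continuous_on_snd_coordinate[OF h(1)])
        then have "continuous_on ({0..1} \<times> ?C) (\<lambda>x. h (snd x) i - (1 - fst x) * p i)"
          by (intro continuous_intros continuous_on_coordinate continuous_on_snd_apply)
        then show "continuous_on ({0..1} \<times> ?C) (\<lambda>x. ?H x i)"
          by (simp add: case_prod_unfold)
      qed
      moreover have "?H \<in> {0..1} \<times> ?C \<rightarrow> topspace ?E"
        using hE pE by (fastforce simp: topspace_Euclidean_space)
      moreover have "(\<lambda>i. h x i - (1 - t) * p i) \<noteq> (\<lambda>i. 0)" if "t \<in> {0..1}" "x \<in> ?S" for t x
        using star[OF p, of "1 - t" "h x"] that h(3) by (auto simp: fun_eq_iff)
      ultimately have "homotopic_with (\<lambda>k. k \<in> ?S \<rightarrow> ?P) ?B ?E ((\<lambda>x i. x i - p i) \<circ> h) h"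
        unfolding homotopic_with_def
        by (intro exI[of _ ?H] conjI) (use SB in \<open>auto simp: cE Pi_iff\<close>)
      then show ?thesis
        by (simp add: homology_homotopy_axiom)
    qed
    also have "\<dots> = hom_induced ?q ?B ?S ?E ?P id \<mu>"
    proof -
      let ?H = "\<lambda>(t, x) i. (1 - t) * h x i + t * x i"
      have "continuous_on ({0..1} \<times> ?C) ?H"
      proof (rule continuous_on_coordinatewise_then_product)
        fix i
        have "continuous_on ({0..1} \<times> ?C) (\<lambda>x. h (snd x) i)"
          by (rule continuous_on_snd_coordinate[OF h(1)])
        then have "continuous_on ({0..1} \<times> ?C) (\<lambda>x. (1 - fst x) * h (snd x) i + fst x * snd x i)"
          by (intro continuous_intros continuous_on_coordinate continuous_on_snd_apply)
        then show "continuous_on ({0..1} \<times> ?C) (\<lambda>x. ?H x i)"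
          by (simp add: case_prod_unfold)
      qed
      moreover have "?H \<in> {0..1} \<times> ?C \<rightarrow> topspace ?E"
        using hE closed_unit_ball_subset[of n] by (fastforce simp: topspace_Euclidean_space)
      ultimately have "homotopic_with (\<lambda>k. k \<in> ?S \<rightarrow> ?P) ?B ?E h id"
        unfolding homotopic_with_def
        by (intro exI[of _ ?H] conjI) (use SB dir in \<open>auto simp: cE Pi_iff\<close>)
      then show ?thesis
        by (simp add: homology_homotopy_axiom)
    qed
    finally show ?thesis using om by simp
  qed
  moreover have "hom_induced (int n) (nsphere n) {} (subtopology ?E M) {} h (hom_boundary ?q ?B ?S \<mu>) = hom_boundary ?q ?X M ?mu"
    using naturality_hom_induced[OF ch h(3), of ?q] unfolding subS subM int_Suc_minus1 by (metis comp_apply)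
  ultimately show ?thesis
    unfolding boundary_fundamental_class_def Let_def
    by (intro bexI[of _ ?mu] conjI ballI) (auto simp: hom_induced_carrier)
qed

text \<open>The fundamental class of \<open>M\<close> is the image under \<open>h\<close> of that of
  the sphere, so \<open>f\<close> sends it where \<open>f \<circ> h\<close> sends the class of the
  sphere. The latter class comes from the preceding lemma with the identity in place of
  \<open>h\<close>. This reduces the degree on \<open>M\<close> to a degree of self-maps of the
  sphere.\<close>

lemma has_Brouwer_degree_pullback:
  assumes n: "n \<ge> 1"
    and DM: "D \<subseteq> topspace (Euclidean_space (Suc n))" "M \<subseteq> topspace (Euclidean_space (Suc n))"
    and h: "continuous_on (closed_unit_ball n) h" "h \<in> closed_unit_ball n \<rightarrow> D \<union> M" "h \<in> topspace (nsphere n) \<rightarrow> M"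
    and star: "\<And>p s x. \<lbrakk>p \<in> D; s \<in> {0..1}; x \<in> M\<rbrakk> \<Longrightarrow> x \<noteq> (\<lambda>i. s * p i)"
    and dir: "\<And>s x. \<lbrakk>s \<in> {0..1}; x \<in> topspace (nsphere n)\<rbrakk> \<Longrightarrow> (\<lambda>i. (1 - s) * h x i + s * x i) \<noteq> (\<lambda>i. 0)"
    and f: "continuous_on M f" "f \<in> M \<rightarrow> topspace (nsphere n)"
  shows "has_Brouwer_degree n D M (unit_ball n) (topspace (nsphere n)) f (Brouwer_degree2 n (f \<circ> h))"
proof -
  let ?q = "int (Suc n)" and ?S = "topspace (nsphere n)"
  let ?B = "top_of_set (closed_unit_ball n)" and ?E = "Euclidean_space (Suc n)"
  obtain \<mu> where mu: "\<mu> \<in> carrier (relative_homology_group ?q ?B ?S)"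
    and om: "euclidean_orientation (Suc n) (hom_induced ?q ?B ?S ?E (punctured_space (Suc n)) id \<mu>)"
    using euclidean_orientation_exists[OF n] by blast
  let ?\<omega> = "hom_induced ?q ?B ?S ?E (punctured_space (Suc n)) id \<mu>"
  let ?z = "hom_boundary ?q ?B ?S \<mu>"
  let ?M = "subtopology ?E M"
  have M: "?M = top_of_set M" using DM by (intro subtopology_Euclidean_eu)
  have SB: "?S \<subseteq> closed_unit_ball n" by (auto simp: closed_unit_ball_def)
  have subS: "subtopology ?B ?S = nsphere n"
    using SB by (subst (2) nsphere_eu) (simp add: subtopology_subtopology Int_absorb1)
  have zc: "?z \<in> carrier (homology_group (int n) (nsphere n))"
    using hom_boundary_carrier[of ?q ?B ?S \<mu>] unfolding subS int_Suc_minus1 .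
  have fc1: "boundary_fundamental_class n ?\<omega> D M (hom_induced (int n) (nsphere n) {} ?M {} h ?z)"
    by (rule boundary_fundamental_class_map[OF DM h star dir mu refl])
  have "boundary_fundamental_class n ?\<omega> (unit_ball n) ?S
      (hom_induced (int n) (nsphere n) {} (subtopology ?E ?S) {} id ?z)"
  proof (rule boundary_fundamental_class_map[OF _ _ _ _ _ _ _ mu refl])
    show "unit_ball n \<subseteq> topspace ?E" by (auto simp: unit_ball_def)
    show "x \<noteq> (\<lambda>i. s * p i)" if p: "p \<in> unit_ball n" and s: "s \<in> {0..1}" and x: "x \<in> ?S" for p s x
    proof
      assume "x = (\<lambda>i. s * p i)"
      then have "(\<Sum>i\<le>n. (x i)\<^sup>2) = s\<^sup>2 * (\<Sum>i\<le>n. (p i)\<^sup>2)"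
        by (simp add: power_mult_distrib sum_distrib_left)
      also have "\<dots> \<le> 1 * (\<Sum>i\<le>n. (p i)\<^sup>2)"
        using s by (intro mult_right_mono) (auto simp: power_le_one sum_nonneg)
      also have "\<dots> < 1" using p by (simp add: unit_ball_def)
      finally show False using x by (simp add: topspace_nsphere)
    qed
    show "(\<lambda>i. (1 - s) * id x i + s * x i) \<noteq> (\<lambda>i. 0)" if "x \<in> ?S" for s x
      using that by (auto simp: topspace_nsphere algebra_simps)
  qed (auto simp: nsphere_subset closed_unit_ball_def)
  then have fc2: "boundary_fundamental_class n ?\<omega> (unit_ball n) ?S ?z"
    using zc by (simp add: subtopology_Euclidean_nsphere hom_induced_id)
  have hS: "continuous_map (nsphere n) ?M h"
    unfolding M by (subst nsphere_eu) (use h(1,3) SB in \<open>auto simp: continuous_map_subtopology_eu intro: continuous_on_subset\<close>)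
  have fM: "continuous_map ?M (nsphere n) f"
    unfolding M by (subst nsphere_eu) (use f in \<open>auto simp: continuous_map_subtopology_eu\<close>)
  have red: "reduced_homology_group (int n) (nsphere n) = homology_group (int n) (nsphere n)"
    using n by (intro un_reduced_homology_group) auto
  have "hom_induced (int n) ?M {} (nsphere n) {} f (hom_induced (int n) (nsphere n) {} ?M {} h ?z)
      = hom_induced (int n) (nsphere n) {} (nsphere n) {} (f \<circ> h) ?z"
    by (rule hom_induced_compose'[OF hS _ fM]) auto
  also have "\<dots> = ?z [^]\<^bsub>homology_group (int n) (nsphere n)\<^esub> Brouwer_degree2 n (f \<circ> h)"
    using Brouwer_degree2[of ?z n "f \<circ> h"] zc unfolding red by simp
  finally show ?thesis
    unfolding has_Brouwer_degree_def Let_def subtopology_Euclidean_nsphere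
    using fM om fc1 fc2 by blast
qed

section \<open>Power maps\<close>

text \<open>\<open>cpow_re k u a b\<close> and \<open>cpow_im k u a b\<close> are \<open>A\<close> and \<open>B\<close> in \<open>(a + b \<surd>(-u))\<^sup>k = A + B \<surd>(-u)\<close>.\<close>

fun cpow_re :: "nat \<Rightarrow> real \<Rightarrow> real \<Rightarrow> real \<Rightarrow> real"
  and cpow_im :: "nat \<Rightarrow> real \<Rightarrow> real \<Rightarrow> real \<Rightarrow> real" where
  "cpow_re 0 u a b = 1"
| "cpow_im 0 u a b = 0"
| "cpow_re (Suc k) u a b = a * cpow_re k u a b - u * b * cpow_im k u a b"
| "cpow_im (Suc k) u a b = a * cpow_im k u a b + b * cpow_re k u a b"

text \<open>Brahmagupta's identity: the norm form of adjoining a square root of \<open>-u\<close> is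
  multiplicative.\<close>

lemma qnorm_mult: "(a * c - u * b * d)\<^sup>2 + u * (a * d + b * c)\<^sup>2 = (a\<^sup>2 + u * b\<^sup>2) * (c\<^sup>2 + u * d\<^sup>2)" for u :: real
  by (simp add: power2_eq_square algebra_simps)

lemma qnorm_cpow: "(cpow_re k u a b)\<^sup>2 + u * (cpow_im k u a b)\<^sup>2 = (a\<^sup>2 + u * b\<^sup>2) ^ k"
  by (induction k) (simp_all add: qnorm_mult)

lemma cpow_im_zero: "cpow_re k u a 0 = a ^ k \<and> cpow_im k u a 0 = 0"
  by (induction k) auto

lemma continuous_on_cpow:
  assumes "continuous_on S u" "continuous_on S a" "continuous_on S b"
  shows "continuous_on S (\<lambda>x. cpow_re k (u x) (a x) (b x)) \<and> continuous_on S (\<lambda>x. cpow_im k (u x) (a x) (b x))"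
  by (induction k) (auto intro!: continuous_intros assms)

section \<open>Maps of the sphere that are determined by the height \<open>x 0\<close>\<close>

definition latitude :: "real \<Rightarrow> real \<Rightarrow> (nat \<Rightarrow> real) \<Rightarrow> nat \<Rightarrow> real" where
  "latitude a b x = (\<lambda>i. if i = 0 then a else b * x i)"

lemma nsphere_split_0:
  assumes "x \<in> topspace (nsphere n)"
  shows "(\<Sum>i\<in>{1..n}. (x i)\<^sup>2) = 1 - (x 0)\<^sup>2"
proof -
  have "{..n} = insert 0 {1..n}" by auto
  then show ?thesis using assms by (simp add: topspace_nsphere)
qed

lemma latitude_norm:
  assumes "x \<in> topspace (nsphere n)"
  shows "(\<Sum>i\<le>n. (latitude a b x i)\<^sup>2) = a\<^sup>2 + (1 - (x 0)\<^sup>2) * b\<^sup>2"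
proof -
  have "{..n} = insert 0 {1..n}" by auto
  then have "(\<Sum>i\<le>n. (latitude a b x i)\<^sup>2) = a\<^sup>2 + (\<Sum>i\<in>{1..n}. b\<^sup>2 * (x i)\<^sup>2)"
    by (simp add: latitude_def power_mult_distrib)
  then show ?thesis
    using nsphere_split_0[OF assms] by (simp flip: sum_distrib_left)
qed

lemma latitude_in_nsphere:
  assumes "x \<in> topspace (nsphere n)" "a\<^sup>2 + (1 - (x 0)\<^sup>2) * b\<^sup>2 = 1"
  shows "latitude a b x \<in> topspace (nsphere n)"
  using assms latitude_norm[OF assms(1), of a b] by (simp add: topspace_nsphere) (simp add: latitude_def)

lemma continuous_on_latitude:
  assumes "continuous_on S a" "continuous_on S b" "\<And>i. continuous_on S (\<lambda>p. f p i)"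
  shows "continuous_on S (\<lambda>p. latitude (a p) (b p) (f p))"
proof (rule continuous_on_coordinatewise_then_product)
  show "continuous_on S (\<lambda>p. latitude (a p) (b p) (f p) i)" for i
    unfolding latitude_def by (cases "i = 0") (auto intro!: continuous_on_mult assms)
qed

lemma continuous_map_latitude:
  fixes a b :: "real \<Rightarrow> real"
  assumes "continuous_on UNIV a" "continuous_on UNIV b"
    and "\<And>t. t\<^sup>2 \<le> 1 \<Longrightarrow> (a t)\<^sup>2 + (1 - t\<^sup>2) * (b t)\<^sup>2 = 1"
  shows "continuous_map (nsphere n) (nsphere n) (\<lambda>x. latitude (a (x 0)) (b (x 0)) x)"
  unfolding continuous_map_nsphere_iff
proof
  show "continuous_on (topspace (nsphere n)) (\<lambda>x. latitude (a (x 0)) (b (x 0)) x)"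
    by (intro continuous_on_latitude continuous_on_compose2[OF assms(1)] continuous_on_compose2[OF assms(2)]
        continuous_on_coordinate) auto
qed (use assms(3) topspace_nsphere_1 in \<open>auto intro!: latitude_in_nsphere\<close>)

text \<open>Homotopies of such maps reduce to pairs of functions of one height variable;
  nonvanishing becomes a condition on a quadratic form in \<open>a\<close> and
  \<open>b\<close>.\<close>

lemma degree_latitude_homotopic:
  fixes a b :: "real \<Rightarrow> real \<Rightarrow> real"
  assumes cont: "continuous_on UNIV (\<lambda>p. a (fst p) (snd p))" "continuous_on UNIV (\<lambda>p. b (fst p) (snd p))"
    and nz: "\<And>s t. \<lbrakk>s \<in> {0..1}; t\<^sup>2 \<le> 1\<rbrakk> \<Longrightarrow> (a s t)\<^sup>2 + (1 - t\<^sup>2) * (b s t)\<^sup>2 \<noteq> 0"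
    and unit: "\<And>s t. \<lbrakk>s = 0 \<or> s = 1; t\<^sup>2 \<le> 1\<rbrakk> \<Longrightarrow> (a s t)\<^sup>2 + (1 - t\<^sup>2) * (b s t)\<^sup>2 = 1"
    and f: "\<And>x. x \<in> topspace (nsphere n) \<Longrightarrow> f x = latitude (a 0 (x 0)) (b 0 (x 0)) x"
    and g: "\<And>x. x \<in> topspace (nsphere n) \<Longrightarrow> g x = latitude (a 1 (x 0)) (b 1 (x 0)) x"
  shows "Brouwer_degree2 n f = Brouwer_degree2 n g"
proof (rule Brouwer_degree2_homotopic_normalize[where H = "\<lambda>s x. latitude (a s (x 0)) (b s (x 0)) x"])
  have *: "continuous_on U (\<lambda>p. (fst p, snd p 0 :: real))" for U :: "(real \<times> (nat \<Rightarrow> real)) set"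
    by (intro continuous_intros continuous_on_snd_apply)
  show "continuous_on ({0..1} \<times> topspace (nsphere n)) (\<lambda>(s, x). latitude (a s (x 0)) (b s (x 0)) x)"
    unfolding case_prod_unfold
    using continuous_on_compose2[OF cont(1) *] continuous_on_compose2[OF cont(2) *]
    by (intro continuous_on_latitude continuous_on_snd_apply) auto
  show "latitude (a t (x 0)) (b t (x 0)) x i = 0" if "x \<in> topspace (nsphere n)" "i > n" for t x i
    using that by (simp add: latitude_def topspace_nsphere)
  show "(\<Sum>i\<le>n. (latitude (a t (x 0)) (b t (x 0)) x i)\<^sup>2) \<noteq> 0" if "t \<in> {0..1}" "x \<in> topspace (nsphere n)" for t x
    using nz[of t "x 0"] that topspace_nsphere_1[OF that(2)] by (simp add: latitude_norm)
qed (use unit topspace_nsphere_1 f g in \<open>auto intro!: latitude_in_nsphere\<close>)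

text \<open>Multiplication by the imaginary unit on \<open>\<complex>\<^sup>r = \<real>\<^sup>2\<^sup>r\<close>.\<close>

definition quarter_turn :: "(nat \<Rightarrow> real) \<Rightarrow> nat \<Rightarrow> real" where
  "quarter_turn x i = (if even i then - x (Suc i) else x (i - 1))"

text \<open>A vector and its \<open>quarter_turn\<close> have equal length and are orthogonal, as
  the mixed terms cancel within each pair of coordinates.\<close>

lemma sum_rotation:
  "(\<Sum>i<2 * r. (c * x i + d * quarter_turn x i)\<^sup>2) = (c\<^sup>2 + d\<^sup>2) * (\<Sum>i<2 * r. (x i)\<^sup>2)"
  by (induction r) (simp_all add: quarter_turn_def power2_eq_square algebra_simps)

lemma sum_rotation_nsphere:
  assumes "odd n" "x \<in> topspace (nsphere n)"
  shows "(\<Sum>i\<le>n. (c * x i + d * quarter_turn x i)\<^sup>2) = c\<^sup>2 + d\<^sup>2"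
proof -
  obtain m where m: "n = 2 * m + 1" using assms(1) by (auto elim: oddE)
  then have "{..n} = {..<2 * Suc m}" by auto
  then show ?thesis using sum_rotation[of c x d "Suc m"] assms(2) by (simp add: topspace_nsphere)
qed

lemma quarter_turn_tail:
  assumes "odd n" "x \<in> topspace (nsphere n)" "i > n"
  shows "quarter_turn x i = 0"
  using assms by (auto simp: quarter_turn_def topspace_nsphere) (metis Suc_lessI Suc_pred even_Suc linorder_neqE_nat not_less_eq not_less_zero)

text \<open>\<open>C + i D\<close> runs through nonzero complex numbers, and multiplication by such
  a number never kills a unit vector. The dimension is odd so that the coordinates pair up.\<close>

lemma degree_rotation_path:
  assumes n: "odd n" and phi: "continuous_map (nsphere n) (nsphere n) \<phi>"
    and C: "continuous_on {0..1} C" and D: "continuous_on {0..1} D"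
    and nz: "\<And>s. s \<in> {0..1::real} \<Longrightarrow> (C s)\<^sup>2 + (D s)\<^sup>2 \<noteq> 0"
    and unit: "(C 0)\<^sup>2 + (D 0)\<^sup>2 = 1" "(C 1)\<^sup>2 + (D 1)\<^sup>2 = 1"
  shows "Brouwer_degree2 n (\<lambda>x i. C 0 * \<phi> x i + D 0 * quarter_turn (\<phi> x) i)
       = Brouwer_degree2 n (\<lambda>x i. C 1 * \<phi> x i + D 1 * quarter_turn (\<phi> x) i)"
proof (rule Brouwer_degree2_homotopic_normalize[where H = "\<lambda>s x i. C s * \<phi> x i + D s * quarter_turn (\<phi> x) i"])
  let ?S = "topspace (nsphere n)"
  have phc: "continuous_on ?S \<phi>" and phS: "\<And>x. x \<in> ?S \<Longrightarrow> \<phi> x \<in> ?S"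
    using phi unfolding continuous_map_nsphere_iff by auto
  have ph: "continuous_on ({0..1} \<times> ?S) (\<lambda>p. \<phi> (snd p) i)" for i
    by (rule continuous_on_snd_coordinate[OF phc])
  have qt: "continuous_on ({0..1} \<times> ?S) (\<lambda>p. quarter_turn (\<phi> (snd p)) i)" for i
    unfolding quarter_turn_def by (cases "even i") (auto intro!: ph continuous_on_minus)
  have CD: "continuous_on ({0..1} \<times> ?S) (\<lambda>p. C (fst p))" "continuous_on ({0..1} \<times> ?S) (\<lambda>p. D (fst p))"
    by (auto intro!: continuous_on_compose2[OF C] continuous_on_compose2[OF D] continuous_on_fst continuous_on_id)
  have "continuous_on ({0..1} \<times> ?S) (\<lambda>p. C (fst p) * \<phi> (snd p) i + D (fst p) * quarter_turn (\<phi> (snd p)) i)" for i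
    by (intro continuous_on_add continuous_on_mult ph qt CD)
  then show "continuous_on ({0..1} \<times> ?S) (\<lambda>(s, x) i. C s * \<phi> x i + D s * quarter_turn (\<phi> x) i)"
    unfolding case_prod_unfold by (rule continuous_on_coordinatewise_then_product)
  show tail: "C t * \<phi> x i + D t * quarter_turn (\<phi> x) i = 0" if "x \<in> ?S" "i > n" for t x i
    using quarter_turn_tail[OF n phS that(2)] that phS[of x] by (simp add: topspace_nsphere)
  show "(\<Sum>i\<le>n. (C t * \<phi> x i + D t * quarter_turn (\<phi> x) i)\<^sup>2) \<noteq> 0" if "t \<in> {0..1}" "x \<in> ?S" for t x
    using nz that by (simp add: sum_rotation_nsphere[OF n phS])
  have "(\<lambda>i. C t * \<phi> x i + D t * quarter_turn (\<phi> x) i) \<in> ?S" if "x \<in> ?S" "t = 0 \<or> t = 1" for t x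
    using tail sum_rotation_nsphere[OF n phS[OF that(1)], of "C t" "D t"] that unit by (auto simp: topspace_nsphere)
  then show "(\<lambda>i. C 0 * \<phi> x i + D 0 * quarter_turn (\<phi> x) i) \<in> ?S \<and>
       (\<lambda>i. C 0 * \<phi> x i + D 0 * quarter_turn (\<phi> x) i) = (\<lambda>i. C 0 * \<phi> x i + D 0 * quarter_turn (\<phi> x) i)"
     "(\<lambda>i. C 1 * \<phi> x i + D 1 * quarter_turn (\<phi> x) i) \<in> ?S \<and>
       (\<lambda>i. C 1 * \<phi> x i + D 1 * quarter_turn (\<phi> x) i) = (\<lambda>i. C 1 * \<phi> x i + D 1 * quarter_turn (\<phi> x) i)"
    if "x \<in> ?S" for x
    using that by auto
qed

text \<open>If the real part is nonnegative, the segment to 1 avoids the origin. Otherwise go first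
  along the segment to \<open>i\<close>, which avoids it as well, and then on to 1.\<close>

lemma degree_rotation:
  assumes n: "odd n" and phi: "continuous_map (nsphere n) (nsphere n) \<phi>" and cd: "c\<^sup>2 + d\<^sup>2 = (1::real)"
  shows "Brouwer_degree2 n (\<lambda>x i. c * \<phi> x i + d * quarter_turn (\<phi> x) i) = Brouwer_degree2 n \<phi>"
proof -
  have sq0: "a\<^sup>2 + b\<^sup>2 \<noteq> 0" if "a \<noteq> 0 \<or> b \<noteq> 0" for a b :: real
    using that by (simp add: sum_power2_eq_zero_iff)
  have nn: "Brouwer_degree2 n (\<lambda>x i. a * \<phi> x i + b * quarter_turn (\<phi> x) i) = Brouwer_degree2 n \<phi>"
    if ab: "a\<^sup>2 + b\<^sup>2 = 1" "a \<ge> 0" for a b :: real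
  proof -
    have "(1 - s) * a + s \<noteq> 0 \<or> (1 - s) * b \<noteq> 0" if s: "s \<in> {0..1}" for s
    proof (cases "s = 0")
      case True
      then show ?thesis using ab by auto
    next
      case False
      then have "(1 - s) * a + s > 0" using s ab(2) by (intro add_nonneg_pos) auto
      then show ?thesis by simp
    qed
    then show ?thesis
      using degree_rotation_path[OF n phi, of "\<lambda>s. (1 - s) * a + s" "\<lambda>s. (1 - s) * b"] ab sq0
      by (simp add: continuous_intros)
  qed
  show ?thesis
  proof (cases "c \<ge> 0")
    case True
    then show ?thesis using nn cd by blast
  next
    case False
    have "(1 - s) * c \<noteq> 0 \<or> (1 - s) * d + s \<noteq> 0" for s
      using False by (cases "s = 1") auto
    then have "Brouwer_degree2 n (\<lambda>x i. c * \<phi> x i + d * quarter_turn (\<phi> x) i)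
        = Brouwer_degree2 n (\<lambda>x i. 0 * \<phi> x i + 1 * quarter_turn (\<phi> x) i)"
      using degree_rotation_path[OF n phi, of "\<lambda>s. (1 - s) * c" "\<lambda>s. (1 - s) * d + s"] cd sq0
      by (simp add: continuous_intros)
    then show ?thesis using nn[of 0 1] by simp
  qed
qed

lemma degree_sign_scaling:
  assumes n: "odd n" and e: "e\<^sup>2 = (1::real)" 
  shows "Brouwer_degree2 n (\<lambda>x i. e * x i) = 1"
  using degree_rotation[OF n continuous_map_id, of e 0] e by simp

text \<open>On the sphere \<open>1 - (x 0)^2\<close> is the squared length of the other coordinates
  z', so this is the \<open>k\<close>-th power of x0 + |z'| I, where the imaginary unit I stands for
  the direction of z'. The length |z'| cancels from the imaginary part, which leaves a polynomial
  formula.\<close>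

definition power_map :: "nat \<Rightarrow> (nat \<Rightarrow> real) \<Rightarrow> nat \<Rightarrow> real" where
  "power_map k x = latitude (cpow_re k (1 - (x 0)\<^sup>2) (x 0) 1) (cpow_im k (1 - (x 0)\<^sup>2) (x 0) 1) x"

lemma continuous_map_power_map: "continuous_map (nsphere n) (nsphere n) (power_map k)"
proof -
  have "continuous_on UNIV (\<lambda>t. 1 - t\<^sup>2 :: real)" by (intro continuous_intros)
  note c = continuous_on_cpow[OF this continuous_on_id continuous_on_const, of k 1]
  show ?thesis
    using continuous_map_latitude[OF conjunct1[OF c] conjunct2[OF c], of n]
    by (simp add: qnorm_cpow power_map_def[abs_def])
qed

text \<open>Doubling the latitude on the upper hemisphere only, or on the lower one only, is homotopic to the
  identity. Hence \<open>\<phi>\<^sup>k\<^sup>+\<^sup>1\<close> is homotopic to the product \<open>g\<close> of the \<open>k\<close>-th power of the first map and of the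
  second map, and \<open>g\<close> is constant on the equator.\<close>

lemma degree_power_map:
  assumes n: "odd n"
  shows "Brouwer_degree2 n (power_map k) = int k"
proof (induction k)
  case 0
  have "power_map 0 = (\<lambda>x i. if i = 0 then 1 else 0)"
    by (simp add: power_map_def latitude_def fun_eq_iff)
  then show ?case by (simp add: Brouwer_degree2_const)
next
  case (Suc k)
  let ?S = "topspace (nsphere n)"
  \<comment> \<open>At \<open>s = 0\<close> this is the identity. At \<open>s = 1\<close> the pair
    \<open>a\<close>, \<open>b\<close> is the square of t + sqrt(-u), with u = 1 - t^2, for t >= 0,
    and the constant -1 for t <= 0.\<close>
  define a where "a s t = (1 - s) * t + s * (2 * (max t 0)\<^sup>2 - 1)" for s t :: real
  define b where "b s t = (1 - s) + 2 * s * max t 0" for s t :: real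
  \<comment> \<open>The mirror image: at \<open>s = 1\<close> the pair \<open>c\<close>,
    \<open>d\<close> is minus that square for t <= 0 and the constant 1 for t >= 0.\<close>
  define c where "c s t = (1 - s) * t + s * (1 - 2 * (max (- t) 0)\<^sup>2)" for s t :: real
  define d where "d s t = (1 - s) + 2 * s * max (- t) 0" for s t :: real
  have ca: "continuous_on U (\<lambda>p. a (fst p) (snd p))" and cb: "continuous_on U (\<lambda>p. b (fst p) (snd p))"
    and cc: "continuous_on U (\<lambda>p. c (fst p) (snd p))" and cd: "continuous_on U (\<lambda>p. d (fst p) (snd p))" for U
    unfolding a_def b_def c_def d_def by (intro continuous_intros)+
  have cu: "continuous_on U (\<lambda>p. 1 - (snd p)\<^sup>2)" for U :: "(real \<times> real) set" by (intro continuous_intros)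
  define A where "A s t = cpow_re k (1 - t\<^sup>2) (a s t) (b s t)" for s t
  define B where "B s t = cpow_im k (1 - t\<^sup>2) (a s t) (b s t)" for s t
  have cA: "continuous_on U (\<lambda>p. A (fst p) (snd p))" and cB: "continuous_on U (\<lambda>p. B (fst p) (snd p))" for U
    unfolding A_def B_def using continuous_on_cpow[OF cu ca cb] by auto
  have nzab: "(a s t)\<^sup>2 + (1 - t\<^sup>2) * (b s t)\<^sup>2 > 0" and nzcd: "(c s t)\<^sup>2 + (1 - t\<^sup>2) * (d s t)\<^sup>2 > 0"
    if s: "s \<in> {0..1}" and t: "t\<^sup>2 \<le> 1" for s t :: real
  proof -
    have ge: "b s t \<ge> 0" "d s t \<ge> 0" using s by (auto simp: b_def d_def)
    have t1: "t = 1 \<or> t = -1" if "t\<^sup>2 = 1" using that by (simp add: power2_eq_1_iff)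
    \<comment> \<open>At the poles the second coordinate carries no weight, so \<open>x\<close> must
      be nonzero there; elsewhere it is enough that \<open>x\<close> and \<open>y\<close> do not
      both vanish.\<close>
    have *: "x\<^sup>2 + (1 - t\<^sup>2) * y\<^sup>2 > 0" if "y = 0 \<Longrightarrow> x \<noteq> 0" "t\<^sup>2 = 1 \<Longrightarrow> x \<noteq> 0" for x y :: real
    proof (cases "x = 0")
      case True
      then have "y \<noteq> 0" "t\<^sup>2 \<noteq> 1" using that by blast+
      then have "y \<noteq> 0" "t\<^sup>2 < 1" using t by (simp_all add: order_less_le)
      then show ?thesis using True by simp
    next
      case False
      then show ?thesis using t by (intro add_pos_nonneg) auto
    qed
    have b0: "s = 1 \<and> max t 0 = 0" if "b s t = 0"
    proof -
      have "0 \<le> 1 - s" "0 \<le> 2 * s * max t 0" using s by auto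
      with that have "1 - s = 0" "2 * s * max t 0 = 0" unfolding b_def by linarith+
      then show ?thesis by simp
    qed
    have d0: "s = 1 \<and> max (- t) 0 = 0" if "d s t = 0"
    proof -
      have "0 \<le> 1 - s" "0 \<le> 2 * s * max (-t) 0" using s by auto
      with that have "1 - s = 0" "2 * s * max (-t) 0 = 0" unfolding d_def by linarith+
      then show ?thesis by simp
    qed
    have "a s 1 = 1" "a s (-1) = -1" "c s 1 = 1" "c s (-1) = -1"
      by (simp_all add: a_def c_def algebra_simps)
    then have "a s t \<noteq> 0" "c s t \<noteq> 0" if "t\<^sup>2 = 1" using t1[OF that] by auto
    moreover have "a s t \<noteq> 0" if "b s t = 0" using b0[OF that] by (simp add: a_def)
    moreover have "c s t \<noteq> 0" if "d s t = 0" using d0[OF that] by (simp add: c_def)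
    ultimately show "(a s t)\<^sup>2 + (1 - t\<^sup>2) * (b s t)\<^sup>2 > 0" "(c s t)\<^sup>2 + (1 - t\<^sup>2) * (d s t)\<^sup>2 > 0"
      using * by blast+
  qed
  have uab: "(a s t)\<^sup>2 + (1 - t\<^sup>2) * (b s t)\<^sup>2 = 1" and ucd: "(c s t)\<^sup>2 + (1 - t\<^sup>2) * (d s t)\<^sup>2 = 1"
    if "s = 0 \<or> s = 1" for s t :: real
    using that by (auto simp: a_def b_def c_def d_def max_def power2_eq_square algebra_simps)
  have nA: "(A s t)\<^sup>2 + (1 - t\<^sup>2) * (B s t)\<^sup>2 = ((a s t)\<^sup>2 + (1 - t\<^sup>2) * (b s t)\<^sup>2) ^ k" for s t
    by (simp add: A_def B_def qnorm_cpow)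
  \<comment> \<open>\<open>X\<close> and \<open>Y\<close> are the parts of the product of the
    \<open>k\<close>-th power of the first map with the second map. At \<open>s = 0\<close> this is
    the power \<open>k + 1\<close>.\<close>
  define X where "X s t = A s t * c s t - (1 - t\<^sup>2) * B s t * d s t" for s t
  define Y where "Y s t = A s t * d s t + B s t * c s t" for s t
  have nXY: "(X s t)\<^sup>2 + (1 - t\<^sup>2) * (Y s t)\<^sup>2
       = ((a s t)\<^sup>2 + (1 - t\<^sup>2) * (b s t)\<^sup>2) ^ k * ((c s t)\<^sup>2 + (1 - t\<^sup>2) * (d s t)\<^sup>2)" for s t
    unfolding X_def Y_def qnorm_mult nA ..
  have cX: "continuous_on U (\<lambda>p. X (fst p) (snd p))" and cY: "continuous_on U (\<lambda>p. Y (fst p) (snd p))" for U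
    unfolding X_def Y_def by (intro continuous_intros cA cB cc cd)+
  define g where "g x = latitude (X 1 (x 0)) (Y 1 (x 0)) x" for x
  define g1 where "g1 x = latitude (A 1 (x 0)) (B 1 (x 0)) x" for x
  \<comment> \<open>On the lower hemisphere the first factor of \<open>g\<close> is the constant
    \<open>(-1) ^ k\<close>. With this sign \<open>g2\<close> agrees with \<open>g\<close> there,
    and on the upper hemisphere it takes the same constant value that \<open>g1\<close> takes on the
    lower one.\<close>
  define g2 where "g2 x = latitude ((-1) ^ k * c 1 (x 0)) ((-1) ^ k * d 1 (x 0)) x" for x
  have sgn2: "((-1) ^ k)\<^sup>2 = (1::real)" by (simp flip: power_mult)
  have sgn: "((-1) ^ k * x)\<^sup>2 = x\<^sup>2" for x :: real by (simp add: power_mult_distrib sgn2)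
  have one: "continuous_on UNIV (\<lambda>t. f 1 t)" if "continuous_on UNIV (\<lambda>p. f (fst p) (snd p))" for f :: "real \<Rightarrow> real \<Rightarrow> real"
    using continuous_on_compose2[OF that, of UNIV "\<lambda>t. (1, t)"] by (simp add: continuous_intros)
  have "Brouwer_degree2 n (power_map (Suc k)) = Brouwer_degree2 n g"
  proof (rule degree_latitude_homotopic[where a = X and b = Y])
    show "(X s t)\<^sup>2 + (1 - t\<^sup>2) * (Y s t)\<^sup>2 \<noteq> 0" if "s \<in> {0..1}" "t\<^sup>2 \<le> 1" for s t
      using nzab[OF that] nzcd[OF that] unfolding nXY by simp
    show "power_map (Suc k) x = latitude (X 0 (x 0)) (Y 0 (x 0)) x" for x
      by (simp add: power_map_def X_def Y_def A_def B_def a_def b_def c_def d_def algebra_simps)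
  qed (auto simp: nXY uab ucd cX cY g_def)
  also have "\<dots> = Brouwer_degree2 n g1 + Brouwer_degree2 n g2"
  proof (rule Brouwer_degree2_add)
    show "continuous_map (nsphere n) (nsphere n) g"
      unfolding g_def by (rule continuous_map_latitude) (auto simp: nXY uab ucd intro: one cX cY)
    show "continuous_map (nsphere n) (nsphere n) g1"
      unfolding g1_def by (rule continuous_map_latitude) (auto simp: nA uab intro: one cA cB)
    show "continuous_map (nsphere n) (nsphere n) g2"
      unfolding g2_def
    proof (rule continuous_map_latitude)
      show "continuous_on UNIV (\<lambda>t. (-1) ^ k * c 1 t)" "continuous_on UNIV (\<lambda>t. (-1) ^ k * d 1 t)"
        by (intro continuous_on_mult continuous_on_const one[OF cc] one[OF cd])+
    qed (simp add: sgn ucd)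
    show "g x = g1 x \<and> g2 x = (\<lambda>i. if i = 0 then (-1) ^ k else 0)" if "0 \<le> x 0" for x
      using that by (auto simp: g_def g1_def g2_def X_def Y_def c_def d_def latitude_def)
    show "g x = g2 x \<and> g1 x = (\<lambda>i. if i = 0 then (-1) ^ k else 0)" if "x 0 \<le> 0" for x
      using that by (auto simp: g_def g1_def g2_def X_def Y_def A_def B_def a_def b_def latitude_def cpow_im_zero)
    have "(\<lambda>i. if i = 0 then (-1) ^ k else 0) = latitude ((-1) ^ k) 0 (\<lambda>i. if i = 0 then 1 else 0)"
      by (auto simp: latitude_def)
    then show "(\<lambda>i. if i = 0 then (-1) ^ k else 0) \<in> ?S"
      using in_topspace_nsphere[of n] by (auto intro!: latitude_in_nsphere simp: sgn2)
  qed
  also have "Brouwer_degree2 n g1 = int k"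
  proof -
    have "Brouwer_degree2 n (power_map k) = Brouwer_degree2 n g1"
    proof (rule degree_latitude_homotopic[where a = A and b = B])
      show "(A s t)\<^sup>2 + (1 - t\<^sup>2) * (B s t)\<^sup>2 \<noteq> 0" if "s \<in> {0..1}" "t\<^sup>2 \<le> 1" for s t
        using nzab[OF that] unfolding nA by simp
      show "power_map k x = latitude (A 0 (x 0)) (B 0 (x 0)) x" for x
        by (simp add: power_map_def A_def B_def a_def b_def)
    qed (auto simp: nA uab cA cB g1_def)
    with Suc.IH show ?thesis by simp
  qed
  also have "Brouwer_degree2 n g2 = 1"
  proof -
    have "Brouwer_degree2 n (\<lambda>x i. (-1) ^ k * x i) = Brouwer_degree2 n g2"
    proof (rule degree_latitude_homotopic[where a = "\<lambda>s t. (-1) ^ k * c s t" and b = "\<lambda>s t. (-1) ^ k * d s t"])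
      show "((-1) ^ k * c s t)\<^sup>2 + (1 - t\<^sup>2) * ((-1) ^ k * d s t)\<^sup>2 \<noteq> 0" if "s \<in> {0..1}" "t\<^sup>2 \<le> 1" for s t
        using nzcd[OF that] unfolding sgn by simp
      show "(\<lambda>i. (-1) ^ k * x i) = latitude ((-1) ^ k * c 0 (x 0)) ((-1) ^ k * d 0 (x 0)) x" for x
        by (auto simp: latitude_def c_def d_def)
    qed (intro continuous_on_mult continuous_on_const cc cd | simp add: sgn ucd g2_def)+
    then show ?thesis using degree_sign_scaling[OF n sgn2] by simp
  qed
  finally show ?case by simp
qed

section \<open>One-variable polynomials\<close>

lemma poly_map_of_real: "poly (map_poly complex_of_real p) (complex_of_real x) = of_real (poly p x)"
  by (induction p) (simp_all add: map_poly_pCons)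

lemma map_poly_of_real_mult:
  "map_poly complex_of_real (p * q) = map_poly complex_of_real p * map_poly complex_of_real q"
  by (rule poly_eqI) (simp add: coeff_map_poly coeff_mult)

lemma map_poly_of_real_add:
  "map_poly complex_of_real (p + q) = map_poly complex_of_real p + map_poly complex_of_real q"
  by (rule poly_eqI) (simp add: coeff_map_poly)

text \<open>Induction on the degree. A positive polynomial has only nonreal complex roots; the
  quadratic factor of a conjugate pair is itself a sum of two squares, and the two-square identity
  multiplies the representations.\<close>

lemma pos_poly_sum_two_squares:
  fixes p :: "real poly"
  assumes "\<And>x. poly p x > 0"
  shows "\<exists>P Q. p = P\<^sup>2 + Q\<^sup>2"
  using assms
proof (induction "degree p" arbitrary: p rule: less_induct)
  case less
  show ?case
  proof (cases "degree p = 0")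
    case True
    then obtain c where c: "p = [:c:]" by (auto elim: degree_eq_zeroE)
    then have "c > 0" using less.prems[of 0] by simp
    then have "p = [:sqrt c:]\<^sup>2 + 0\<^sup>2" by (simp add: c power2_eq_square)
    then show ?thesis by blast
  next
    case False
    let ?c = "map_poly complex_of_real"
    have "degree (?c p) \<noteq> 0" using False by (simp add: degree_map_poly)
    then have "\<not> constant (poly (?c p))" by (simp add: constant_degree)
    then obtain a where a: "poly (?c p) a = 0" using fundamental_theorem_of_algebra by blast
    have im: "Im a \<noteq> 0"
    proof
      assume "Im a = 0"
      then have "a = complex_of_real (Re a)" by (simp add: complex_eq_iff)
      then have "poly p (Re a) = 0" using a by (metis poly_map_of_real of_real_eq_0_iff)
      then show False using less.prems[of "Re a"] by simp
    qed
    define q where "q = [:(Re a)\<^sup>2 + (Im a)\<^sup>2, - 2 * Re a, 1:]"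
    have qpos: "poly q x > 0" for x
    proof -
      have "poly q x = (x - Re a)\<^sup>2 + (Im a)\<^sup>2" by (simp add: q_def power2_eq_square algebra_simps)
      then show ?thesis using im by (simp add: add_nonneg_pos)
    qed
    have qa: "poly (?c q) a = 0"
      by (simp add: q_def map_poly_pCons complex_eq_iff power2_eq_square algebra_simps)
    have q0: "q \<noteq> 0" and dq: "degree q = 2" by (simp_all add: q_def)
    \<comment> \<open>A real polynomial of degree at most 1 that vanishes at the nonreal
      \<open>a\<close> is zero, hence \<open>q\<close> divides \<open>p\<close>.\<close>
    have "degree (p mod q) < 2" using degree_mod_less[OF q0, of p] dq by auto
    then have "p mod q = [:coeff (p mod q) 0, coeff (p mod q) 1:]"
      by (intro poly_eqI) (auto simp: coeff_pCons coeff_eq_0 split: nat.split)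
    then obtain r0 r1 where r: "p mod q = [:r0, r1:]" by blast
    have "poly (?c p) a = poly (?c (p div q * q + p mod q)) a" by simp
    then have "poly (?c (p mod q)) a = 0"
      using a qa unfolding map_poly_of_real_add map_poly_of_real_mult by simp
    then have "complex_of_real r0 + a * complex_of_real r1 = 0"
      by (simp add: r map_poly_pCons)
    then have "r1 = 0" "r0 = 0" using im by (auto simp: complex_eq_iff)
    then have pq: "p = p div q * q" using r by (metis add.right_neutral div_mult_mod_eq pCons_0_0)
    define d where "d = p div q"
    have p: "p = d * q" using pq d_def by simp
    have "poly d x > 0" for x
      using less.prems[of x] qpos[of x] by (simp add: p zero_less_mult_iff)
    moreover have "degree d < degree p"
    proof -
      have "d \<noteq> 0" using less.prems[of 0] by (auto simp: p)
      then show ?thesis using q0 dq by (simp add: p degree_mult_eq)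
    qed
    ultimately obtain P Q where PQ: "d = P\<^sup>2 + Q\<^sup>2" using less.hyps by blast
    have "q = [:- Re a, 1:]\<^sup>2 + [:Im a:]\<^sup>2" by (simp add: q_def power2_eq_square)
    then have "p = (P * [:- Re a, 1:] - Q * [:Im a:])\<^sup>2 + (P * [:Im a:] + Q * [:- Re a, 1:])\<^sup>2"
      by (simp only: p PQ) (simp only: power2_eq_square algebra_simps)
    then show ?thesis by blast
  qed
qed

text \<open>The squares of real leading coefficients cannot cancel.\<close>

lemma degree_sum_two_squares:
  fixes P Q :: "real poly"
  shows "2 * degree P \<le> degree (P\<^sup>2 + Q\<^sup>2)"
proof -
  have *: "2 * degree A \<le> degree (A\<^sup>2 + B\<^sup>2)" if "degree B \<le> degree A" for A B :: "real poly"
  proof (cases "A = 0")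
    case False
    have cB: "coeff (B\<^sup>2) (2 * degree A) = (coeff B (degree A))\<^sup>2"
    proof -
      have "coeff (B * B) (2 * degree A) = (\<Sum>i\<le>2 * degree A. coeff B i * coeff B (2 * degree A - i))"
        by (simp add: coeff_mult)
      also have "\<dots> = (\<Sum>i\<in>{degree A}. coeff B i * coeff B (2 * degree A - i))"
      proof (rule sum.mono_neutral_right)
        show "\<forall>i\<in>{..2 * degree A} - {degree A}. coeff B i * coeff B (2 * degree A - i) = 0"
        proof
          fix i assume i: "i \<in> {..2 * degree A} - {degree A}"
          then have "i > degree B \<or> 2 * degree A - i > degree B" using that by auto
          then show "coeff B i * coeff B (2 * degree A - i) = 0" by (auto simp: coeff_eq_0)
        qed
      qed auto
      finally show ?thesis by (simp add: power2_eq_square mult_2)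
    qed
    have "coeff (A\<^sup>2) (2 * degree A) = (lead_coeff A)\<^sup>2"
      by (simp add: power2_eq_square mult_2 coeff_mult_degree_sum)
    then have "coeff (A\<^sup>2 + B\<^sup>2) (2 * degree A) > 0"
      using False cB by (simp add: add_pos_nonneg)
    then show ?thesis by (metis le_degree less_irrefl)
  qed simp
  show ?thesis
  proof (cases "degree Q \<le> degree P")
    case False
    then show ?thesis using *[of P Q] by (simp add: add.commute)
  qed (use * in blast)
qed

text \<open>The variable of \<open>g\<close> and \<open>v\<close> is y = t^2, and negative y are
  needed too. The equation for T' becomes g + 2 y g' = c (1 - y)^(m-1). Then R = 1 - y g^2 has R' =
  -c g (1 - y)^(m-1), so R vanishes to order m at 1, and the sign of \<open>v\<close> can be read
  off from the monotonicity of R.\<close>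

lemma flat_polynomial:
  assumes m: "m \<ge> 1"
  shows "\<exists>g v :: real poly. 1 - [:0, 1:] * g\<^sup>2 = [:1, -1:] ^ m * v \<and> degree g \<le> m - 1 \<and> degree v \<le> m - 1 \<and>
    (\<forall>x\<le>1. poly g x > 0) \<and> (\<forall>x\<le>1. poly v x > 0) \<and> (odd m \<longrightarrow> (\<forall>x. poly v x > 0))"
proof -
  define p where "p = [:1, -1:: real:] ^ (m - 1)"
  have dp: "degree p = m - 1" by (simp add: p_def degree_power_eq)
  have px: "poly p x = (1 - x) ^ (m - 1)" for x by (simp add: p_def poly_power)
  \<comment> \<open>Termwise integration of (1 - t^2)^(m-1) from 0, divided by t; integrating t^(2j)
    produces the denominators \<open>2 * j + 1\<close>.\<close>
  define g0 where "g0 = (\<Sum>j<m. monom (coeff p j / real (2 * j + 1)) j)"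
  have cg0: "coeff g0 j = coeff p j / real (2 * j + 1)" for j
  proof -
    have "coeff g0 j = (if j < m then coeff p j / real (2 * j + 1) else 0)"
      by (simp add: g0_def coeff_sum coeff_monom cong: if_cong)
    then show ?thesis using dp m by (auto simp: coeff_eq_0)
  qed
  have dg0: "degree g0 \<le> m - 1"
    using dp by (intro degree_le) (simp add: cg0 coeff_eq_0)
  have ode0: "g0 + [:0, 2:] * pderiv g0 = p"
  proof (rule poly_eqI)
    fix j
    have "coeff (g0 + [:0, 2:] * pderiv g0) j = real (2 * j + 1) * coeff g0 j"
      by (cases j) (simp_all add: coeff_pCons coeff_pderiv algebra_simps)
    also have "\<dots> = coeff p j"
      unfolding cg0 by (simp del: of_nat_add of_nat_mult of_nat_Suc)
    finally show "coeff (g0 + [:0, 2:] * pderiv g0) j = coeff p j" .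
  qed
  have pos0: "poly g0 x > 0" if x: "x \<le> 1 \<or> odd m" for x
  proof (cases "x = 0")
    case True
    then show ?thesis by (simp add: poly_0_coeff_0 cg0) (simp add: px flip: poly_0_coeff_0)
  next
    case False
    \<comment> \<open>Writing x = e r^2 with a sign \<open>e\<close> treats positive and negative x
      by the same real primitive: \<open>F\<close> has derivative (1 - e t^2)^(m-1).\<close>
    define e where "e = sgn x"
    define r where "r = sqrt \<bar>x\<bar>"
    have r: "r > 0" "e * r\<^sup>2 = x" using False by (simp_all add: r_def e_def sgn_mult_abs)
    define F where "F t = t * poly g0 (e * t\<^sup>2)" for t
    have e2: "e * t\<^sup>2 \<le> t\<^sup>2" for t using False by (auto simp: e_def sgn_if)
    have dF: "(F has_real_derivative (1 - e * t\<^sup>2) ^ (m - 1)) (at t)" for t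
    proof -
      have "(F has_real_derivative (poly g0 (e * t\<^sup>2) + t * (poly (pderiv g0) (e * t\<^sup>2) * (e * (2 * t))))) (at t)"
        unfolding F_def by (auto intro!: derivative_eq_intros poly_DERIV[THEN DERIV_chain2])
      also have "poly g0 (e * t\<^sup>2) + t * (poly (pderiv g0) (e * t\<^sup>2) * (e * (2 * t)))
          = poly (g0 + [:0, 2:] * pderiv g0) (e * t\<^sup>2)"
        by (simp add: power2_eq_square algebra_simps)
      also have "\<dots> = (1 - e * t\<^sup>2) ^ (m - 1)" by (simp only: ode0 px)
      finally show ?thesis .
    qed
    have F0: "F 0 = 0" by (simp add: F_def)
    have inc: "F s > 0" if s: "0 < s" "e * s\<^sup>2 \<le> 1" for s
    proof -
      have "F 0 < F s"
      proof (rule DERIV_pos_imp_increasing_open[OF s(1)])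
        fix t assume t: "0 < t" "t < s"
        have "e * t\<^sup>2 < 1"
        proof (cases "e > 0")
          case True
          then have "e = 1" using False by (auto simp: e_def sgn_if split: if_splits)
          then show ?thesis using t s power_strict_mono[of t s 2] by simp
        next
          case False
          then show ?thesis using t by (smt (verit) mult_nonpos_nonneg zero_le_power2)
        qed
        then show "\<exists>y. (F has_real_derivative y) (at t) \<and> 0 < y" using dF by (intro exI conjI) auto
      qed (use dF DERIV_isCont in \<open>blast intro: continuous_at_imp_continuous_on\<close>)
      then show ?thesis using F0 by simp
    qed
    have "F r > 0"
    proof (cases "x \<le> 1")
      case True
      then show ?thesis using inc[of r] r by simp
    next
      case False
      then have e1: "e = 1" by (simp add: e_def)
      have "r \<ge> 1" using False by (simp add: r_def)
      have "odd m" using x False by blast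
      \<comment> \<open>Beyond 1 the derivative is an even power, because \<open>m\<close> is odd,
        so \<open>F\<close> stays above its positive value at 1.\<close>
      have "F 1 \<le> F r"
      proof (rule DERIV_nonneg_imp_nondecreasing[OF \<open>r \<ge> 1\<close>])
        show "\<exists>y. (F has_real_derivative y) (at t) \<and> 0 \<le> y" for t
          using dF[of t] \<open>odd m\<close> by (intro exI[of _ "(1 - e * t\<^sup>2) ^ (m - 1)"]) (simp add: zero_le_even_power)
      qed
      then show ?thesis using inc[of 1] e1 by simp
    qed
    then show ?thesis using r by (simp add: F_def zero_less_mult_iff)
  qed
  \<comment> \<open>Normalizes \<open>g\<close> to have the value 1 at 1, which makes
    \<open>R\<close> vanish there.\<close>
  define c where "c = inverse (poly g0 1)"
  have c: "c > 0" using pos0[of 1] by (simp add: c_def)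
  define g where "g = smult c g0"
  have g1: "poly g 1 = 1" using pos0[of 1] by (simp add: g_def c_def)
  have gpos: "poly g x > 0" if "x \<le> 1 \<or> odd m" for x using pos0[OF that] c by (simp add: g_def)
  have ode: "g + [:0, 2:] * pderiv g = smult c p"
    unfolding g_def pderiv_smult ode0[symmetric] by (simp add: smult_add_right)
  define R where "R = 1 - [:0, 1:] * g\<^sup>2"
  have R': "pderiv R = smult (- c) (g * p)"
  proof -
    have two: "x * 2 = smult 2 x" for x :: "real poly"
      by (simp add: numeral_poly)
    have "pderiv R = - (g * (g + [:0, 2:] * pderiv g))"
      by (simp add: R_def pderiv_diff pderiv_mult power2_eq_square pderiv_pCons algebra_simps two)
    then show ?thesis by (simp only: ode) simp
  qed
  have R1: "poly R 1 = 0" and R0: "poly R 0 = 1" by (simp_all add: R_def g1)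
  have pneg: "[:1, -1:] ^ k = smult ((-1) ^ k) ([:-1, 1:: real:] ^ k)" for k
  proof -
    have "[:1, -1:] = smult (-1) [:-1, 1:: real:]" by simp
    then show ?thesis by (metis smult_power)
  qed
  \<comment> \<open>The derivative of \<open>R\<close> has order exactly \<open>m - 1\<close> at 1
    since \<open>g\<close> does not vanish there, and \<open>R\<close> itself vanishes at 1; so its
    order is \<open>m\<close>.\<close>
  have "[:-1, 1:] ^ m dvd R"
  proof -
    have "R \<noteq> 0" using R0 by auto
    have "order 1 g = 0" using g1 by (simp add: order_0I)
    moreover have "order 1 p = m - 1" using order_power_n_n[of "1::real" "m - 1"] by (simp add: p_def pneg order_smult)
    moreover have "g * p \<noteq> 0" using g1 by (auto simp: p_def)
    ultimately have "order 1 (pderiv R) = m - 1" using c by (simp add: R' order_smult order_mult del: smult_minus_left)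
    then have "order 1 R = m" using order_pderiv[OF \<open>R \<noteq> 0\<close> R1] m by simp
    then show ?thesis using order_1[of 1 R] by simp
  qed
  then obtain w where w: "R = [:-1, 1:] ^ m * w" by (elim dvdE)
  define v where "v = smult ((-1) ^ m) w"
  have Rv: "R = [:1, -1:] ^ m * v"
    by (simp add: v_def w pneg flip: power_mult_distrib)
  have Rvx: "poly R x = (1 - x) ^ m * poly v x" for x by (simp add: Rv poly_power)
  have dR: "(poly R has_real_derivative - (c * poly g x * (1 - x) ^ (m - 1))) (at x)" for x
    using poly_DERIV[of R x] by (simp add: R' px mult.assoc)
  \<comment> \<open>Monotonicity says nothing about \<open>v\<close> at 1 itself. Differentiating
    the factorization of \<open>R\<close> and cancelling \<open>p\<close> yields m v(1) = c
    there.\<close>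
  have v1: "poly v 1 > 0"
  proof -
    have pm: "[:1, -1:] ^ m = [:1, -1:] * p" using m by (simp add: p_def flip: power_Suc)
    have "pderiv ([:1, -1:] ^ m) = smult (- real m) p"
    proof -
      obtain k where "m = Suc k" using m by (cases m) auto
      then show ?thesis by (simp add: p_def pderiv_power_Suc pderiv_pCons del: power_Suc)
    qed
    then have "pderiv R = p * ([:1, -1:] * pderiv v - smult (real m) v)"
      by (simp add: Rv pderiv_mult[of "_ ^ m"]) (simp add: pm algebra_simps)
    then have "p * ([:1, -1:] * pderiv v - smult (real m) v) = p * smult (- c) g"
      by (simp add: R' mult.commute)
    moreover have "p \<noteq> 0" by (simp add: p_def)
    ultimately have "[:1, -1:] * pderiv v - smult (real m) v = smult (- c) g"
      by (metis mult_left_cancel)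
    then have "poly ([:1, -1:] * pderiv v - smult (real m) v) 1 = poly (smult (- c) g) 1" by simp
    then have "real m * poly v 1 = c" using g1 by simp
    then show ?thesis using c m by (metis of_nat_0_less_iff zero_less_mult_pos less_le_trans zero_less_one)
  qed
  have vlt: "poly v x > 0" if "x < 1" for x
  proof -
    have "poly R 1 < poly R x"
    proof (rule DERIV_neg_imp_decreasing_open[OF that])
      fix t assume "x < t" "t < 1"
      then show "\<exists>y. (poly R has_real_derivative y) (at t) \<and> y < 0"
        using dR[of t] gpos[of t] c by (intro exI conjI) auto
    qed (intro continuous_intros)
    then have "(1 - x) ^ m * poly v x > 0" unfolding R1 by (simp only: Rvx)
    moreover have "(1 - x) ^ m > 0" using that by simp
    ultimately show ?thesis by (simp only: zero_less_mult_pos)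
  qed
  \<comment> \<open>For odd \<open>m\<close> the function R keeps decreasing past 1 and becomes
    negative, as does (1 - x)^m, so the quotient is positive.\<close>
  have vgt: "poly v x > 0" if "x > 1" "odd m" for x
  proof -
    have "poly R x < poly R 1"
    proof (rule DERIV_neg_imp_decreasing_open[OF that(1)])
      fix t assume t: "1 < t" "t < x"
      then have "(1 - t) ^ (m - 1) > 0" using that(2) by (intro zero_less_power_eq[THEN iffD2]) auto
      then show "\<exists>y. (poly R has_real_derivative y) (at t) \<and> y < 0"
        using dR[of t] gpos[of t] c that(2) by (intro exI conjI) auto
    qed (intro continuous_intros)
    then have "(1 - x) ^ m * poly v x < 0" unfolding R1 by (simp only: Rvx)
    moreover have "(1 - x) ^ m < 0" using that by (simp add: power_less_zero_eq)
    ultimately show ?thesis by (simp add: mult_less_0_iff)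
  qed
  have dg: "degree g \<le> m - 1" using dg0 by (simp add: g_def)
  have dv: "degree v \<le> m - 1"
  proof -
    have "v \<noteq> 0" using v1 by auto
    then have "degree R = m + degree v" by (simp add: Rv degree_mult_eq degree_power_eq)
    moreover have "degree ([:0, 1:] * g\<^sup>2) \<le> 1 + 2 * (m - 1)"
    proof -
      have "degree (g\<^sup>2) \<le> 2 * (m - 1)" using degree_power_le[of g 2] dg by (simp add: mult.commute)
      then show ?thesis using degree_mult_le[of "[:0, 1:]" "g\<^sup>2"] by simp
    qed
    then have "degree R \<le> 1 + 2 * (m - 1)" unfolding R_def by (intro degree_diff_le) auto
    ultimately show ?thesis using m by linarith
  qed
  show ?thesis
  proof (intro exI conjI allI impI)
    show "1 - [:0, 1:] * g\<^sup>2 = [:1, -1:] ^ m * v" using Rv by (simp add: R_def)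
    show "poly v x > 0" if "x \<le> 1" for x using vlt[of x] v1 that by (cases "x = 1") auto
    show "poly v x > 0" if "odd m" for x using vlt[of x] v1 vgt[of x] that by (cases x "1::real" rule: linorder_cases) auto
  qed (use dg dv gpos in auto)
qed

section \<open>Polynomial functions of several variables\<close>

definition monomial_eval :: "(nat \<Rightarrow>\<^sub>0 nat) \<Rightarrow> (nat \<Rightarrow> real) \<Rightarrow> real" where
  "monomial_eval e x = (\<Prod>i\<in>Poly_Mapping.keys e. x i ^ Poly_Mapping.lookup e i)"

definition monomial_degree :: "(nat \<Rightarrow>\<^sub>0 nat) \<Rightarrow> nat" where
  "monomial_degree e = (\<Sum>i\<in>Poly_Mapping.keys e. Poly_Mapping.lookup e i)"

lemma monomial_eval_superset:
  assumes "finite I" "Poly_Mapping.keys e \<subseteq> I"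
  shows "monomial_eval e x = (\<Prod>i\<in>I. x i ^ Poly_Mapping.lookup e i)"
  unfolding monomial_eval_def
  by (rule prod.mono_neutral_left[OF assms]) (simp add: in_keys_iff)

lemma monomial_degree_superset:
  assumes "finite I" "Poly_Mapping.keys e \<subseteq> I"
  shows "monomial_degree e = (\<Sum>i\<in>I. Poly_Mapping.lookup e i)"
  unfolding monomial_degree_def
  by (rule sum.mono_neutral_left[OF assms]) (simp add: in_keys_iff)

lemma monomial_eval_add: "monomial_eval (e + e') x = monomial_eval e x * monomial_eval e' x"
proof -
  let ?I = "Poly_Mapping.keys e \<union> Poly_Mapping.keys e'"
  have "Poly_Mapping.keys (e + e') \<subseteq> ?I" by (rule Poly_Mapping.keys_add)
  then show ?thesis
    by (simp add: monomial_eval_superset[of ?I] lookup_add power_add prod.distrib)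
qed

lemma monomial_degree_add: "monomial_degree (e + e') = monomial_degree e + monomial_degree e'"
proof -
  let ?I = "Poly_Mapping.keys e \<union> Poly_Mapping.keys e'"
  have "Poly_Mapping.keys (e + e') \<subseteq> ?I" by (rule Poly_Mapping.keys_add)
  then show ?thesis
    by (simp add: monomial_degree_superset[of ?I] lookup_add sum.distrib)
qed

lemma mpoly_eval_superset:
  assumes "finite K" "Poly_Mapping.keys P \<subseteq> K"
  shows "mpoly_eval P x = (\<Sum>e\<in>K. Poly_Mapping.lookup P e * monomial_eval e x)"
  unfolding mpoly_eval_def monomial_eval_def
  by (rule sum.mono_neutral_left[OF assms]) (simp add: in_keys_iff)

text \<open>\<open>A = {d}\<close> gives the forms of degree \<open>d\<close>, \<open>A = UNIV\<close> all polynomial functions.\<close>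

definition mpoly_fun :: "nat \<Rightarrow> nat set \<Rightarrow> ((nat \<Rightarrow> real) \<Rightarrow> real) \<Rightarrow> bool" where
  "mpoly_fun m A f \<longleftrightarrow> (\<exists>P. mpoly_in m P \<and> (\<forall>e\<in>Poly_Mapping.keys P. monomial_degree e \<in> A) \<and> mpoly_eval P = f)"

lemma mpoly_fun_0: "mpoly_fun m A (\<lambda>x. 0)"
  unfolding mpoly_fun_def by (intro exI[of _ 0]) (auto simp: mpoly_in_def mpoly_eval_def fun_eq_iff)

lemma mpoly_fun_monomial:
  assumes "Poly_Mapping.keys e \<subseteq> {..<m}" "monomial_degree e \<in> A"
  shows "mpoly_fun m A (\<lambda>x. c * monomial_eval e x)"
  unfolding mpoly_fun_def
  by (intro exI[of _ "Poly_Mapping.single e c"])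
    (use assms in \<open>auto simp: mpoly_in_def fun_eq_iff mpoly_eval_superset[of "{e}"]\<close>)

lemma mpoly_fun_add:
  assumes "mpoly_fun m A f" "mpoly_fun m A g"
  shows "mpoly_fun m A (\<lambda>x. f x + g x)"
proof -
  obtain P Q where P: "mpoly_in m P" "\<forall>e\<in>Poly_Mapping.keys P. monomial_degree e \<in> A" "mpoly_eval P = f"
    and Q: "mpoly_in m Q" "\<forall>e\<in>Poly_Mapping.keys Q. monomial_degree e \<in> A" "mpoly_eval Q = g"
    using assms unfolding mpoly_fun_def by blast
  let ?K = "Poly_Mapping.keys P \<union> Poly_Mapping.keys Q"
  have K: "Poly_Mapping.keys (P + Q) \<subseteq> ?K" by (rule Poly_Mapping.keys_add)
  have "mpoly_eval (P + Q) x = f x + g x" for x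
    unfolding P(3)[symmetric] Q(3)[symmetric]
    using K by (simp add: mpoly_eval_superset[of ?K] lookup_add distrib_right sum.distrib)
  moreover have "mpoly_in m (P + Q)" using P(1) Q(1) K unfolding mpoly_in_def by blast
  moreover have "\<forall>e\<in>Poly_Mapping.keys (P + Q). monomial_degree e \<in> A" using P(2) Q(2) K by blast
  ultimately show ?thesis unfolding mpoly_fun_def by (intro exI[of _ "P + Q"]) auto
qed

lemma mpoly_fun_sum:
  assumes "\<And>i. i \<in> I \<Longrightarrow> mpoly_fun m A (f i)"
  shows "mpoly_fun m A (\<lambda>x. \<Sum>i\<in>I. f i x)"
proof (cases "finite I")
  case True
  then show ?thesis using assms
    by (induction I rule: finite_induct) (auto intro!: mpoly_fun_0 mpoly_fun_add)
qed (simp add: mpoly_fun_0)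

lemma mpoly_fun_mult:
  assumes f: "mpoly_fun m A f" and g: "mpoly_fun m B g"
    and C: "\<And>a b. \<lbrakk>a \<in> A; b \<in> B\<rbrakk> \<Longrightarrow> a + b \<in> C"
  shows "mpoly_fun m C (\<lambda>x. f x * g x)"
proof -
  obtain P Q where P: "mpoly_in m P" "\<forall>e\<in>Poly_Mapping.keys P. monomial_degree e \<in> A" "mpoly_eval P = f"
    and Q: "mpoly_in m Q" "\<forall>e\<in>Poly_Mapping.keys Q. monomial_degree e \<in> B" "mpoly_eval Q = g"
    using f g unfolding mpoly_fun_def by blast
  have "f x * g x = (\<Sum>e\<in>Poly_Mapping.keys P. \<Sum>e'\<in>Poly_Mapping.keys Q.
      (Poly_Mapping.lookup P e * Poly_Mapping.lookup Q e') * monomial_eval (e + e') x)" for x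
    unfolding P(3)[symmetric] Q(3)[symmetric]
    by (simp add: mpoly_eval_superset[OF finite_keys order_refl] sum_product monomial_eval_add mult_ac)
  moreover have "mpoly_fun m C (\<lambda>x. \<Sum>e\<in>Poly_Mapping.keys P. \<Sum>e'\<in>Poly_Mapping.keys Q.
      (Poly_Mapping.lookup P e * Poly_Mapping.lookup Q e') * monomial_eval (e + e') x)"
  proof (intro mpoly_fun_sum mpoly_fun_monomial)
    fix e e' assume e: "e \<in> Poly_Mapping.keys P" "e' \<in> Poly_Mapping.keys Q"
    then show "Poly_Mapping.keys (e + e') \<subseteq> {..<m}"
      using P(1) Q(1) Poly_Mapping.keys_add[of e e'] unfolding mpoly_in_def by blast
    show "monomial_degree (e + e') \<in> C"
      using e P(2) Q(2) C by (simp add: monomial_degree_add)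
  qed
  ultimately show ?thesis by simp
qed

lemma mpoly_fun_const: "0 \<in> A \<Longrightarrow> mpoly_fun m A (\<lambda>x. c)"
  using mpoly_fun_monomial[of 0 m A c] by (simp add: monomial_eval_def monomial_degree_def)

lemma mpoly_fun_var: "\<lbrakk>i < m; 1 \<in> A\<rbrakk> \<Longrightarrow> mpoly_fun m A (\<lambda>x. x i)"
  using mpoly_fun_monomial[of "Poly_Mapping.single i 1" m A 1]
  by (simp add: monomial_eval_def monomial_degree_def)

lemma mpoly_fun_cmult: "mpoly_fun m A f \<Longrightarrow> mpoly_fun m A (\<lambda>x. c * f x)"
  using mpoly_fun_mult[OF mpoly_fun_const[of "{0}"], of m A f A c] by simp

lemma mpoly_fun_minus: "mpoly_fun m A f \<Longrightarrow> mpoly_fun m A (\<lambda>x. - f x)"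
  using mpoly_fun_cmult[of m A f "-1"] by simp

lemma mpoly_fun_diff: "\<lbrakk>mpoly_fun m A f; mpoly_fun m A g\<rbrakk> \<Longrightarrow> mpoly_fun m A (\<lambda>x. f x - g x)"
  using mpoly_fun_add[OF _ mpoly_fun_minus, of m A f g] by simp

lemma mpoly_fun_mono: "\<lbrakk>mpoly_fun m A f; A \<subseteq> B\<rbrakk> \<Longrightarrow> mpoly_fun m B f"
  unfolding mpoly_fun_def by blast

lemma mpoly_fun_power: "mpoly_fun m {d} f \<Longrightarrow> mpoly_fun m {k * d} (\<lambda>x. f x ^ k)"
  by (induction k) (auto intro: mpoly_fun_const mpoly_fun_mult)

lemma mpoly_fun_power_UNIV: "mpoly_fun m UNIV f \<Longrightarrow> mpoly_fun m UNIV (\<lambda>x. f x ^ k)"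
  by (induction k) (auto intro: mpoly_fun_const mpoly_fun_mult)

lemma mpoly_fun_sum_squares:
  assumes "I \<subseteq> {..<m}"
  shows "mpoly_fun m {2} (\<lambda>x. \<Sum>i\<in>I. (x i)\<^sup>2)"
  using assms mpoly_fun_power[OF mpoly_fun_var, of _ m 1 2] by (intro mpoly_fun_sum) auto

lemma mpoly_fun_poly: "mpoly_fun m UNIV f \<Longrightarrow> mpoly_fun m UNIV (\<lambda>x. poly P (f x))"
  unfolding poly_altdef by (intro mpoly_fun_sum mpoly_fun_cmult mpoly_fun_power_UNIV)

text \<open>For \<open>degree P\<close> at most \<open>d\<close> and nonzero \<open>s\<close> this
  is \<open>s ^ d * poly P (w / s)\<close>.\<close>

definition homogenize :: "nat \<Rightarrow> real poly \<Rightarrow> real \<Rightarrow> real \<Rightarrow> real" where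
  "homogenize d P w s = (\<Sum>j\<le>d. coeff P j * (w ^ j * s ^ (d - j)))"

lemma homogenize_1: "degree P \<le> d \<Longrightarrow> homogenize d P w 1 = poly P w"
  unfolding homogenize_def poly_altdef
  by (simp, rule sum.mono_neutral_right) (auto simp: coeff_eq_0)

lemma mpoly_fun_homogenize:
  assumes "mpoly_fun m {2} w" "mpoly_fun m {2} s"
  shows "mpoly_fun m {2 * d} (\<lambda>x. homogenize d P (w x) (s x))"
  unfolding homogenize_def
proof (intro mpoly_fun_sum mpoly_fun_cmult)
  fix j assume "j \<in> {..d}"
  then show "mpoly_fun m {2 * d} (\<lambda>x. w x ^ j * s x ^ (d - j))"
    by (intro mpoly_fun_mult[OF mpoly_fun_power[OF assms(1)] mpoly_fun_power[OF assms(2)]]) auto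
qed

text \<open>Give sqrt(-u) weight 1. The imaginary part then has degree one less than
  \<open>k\<close>; the set \<open>{d. Suc d = k}\<close> is empty for \<open>k = 0\<close>, which
  matches the zero function and avoids truncated subtraction.\<close>

lemma mpoly_fun_cpow:
  assumes u: "mpoly_fun m {2} u" and a: "mpoly_fun m {1} a"
  shows "mpoly_fun m {k} (\<lambda>x. cpow_re k (u x) (a x) 1) \<and> mpoly_fun m {d. Suc d = k} (\<lambda>x. cpow_im k (u x) (a x) 1)"
proof (induction k)
  case 0
  then show ?case by (simp add: mpoly_fun_const mpoly_fun_0)
next
  case (Suc k)
  have "mpoly_fun m {Suc k} (\<lambda>x. a x * cpow_re k (u x) (a x) 1)"
    by (rule mpoly_fun_mult[OF a conjunct1[OF Suc]]) auto
  moreover have "mpoly_fun m {Suc k} (\<lambda>x. u x * cpow_im k (u x) (a x) 1)"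
    by (rule mpoly_fun_mult[OF u conjunct2[OF Suc]]) auto
  moreover have "mpoly_fun m {d. Suc d = Suc k} (\<lambda>x. a x * cpow_im k (u x) (a x) 1)"
    by (rule mpoly_fun_mult[OF a conjunct2[OF Suc]]) auto
  moreover have "mpoly_fun m {d. Suc d = Suc k} (\<lambda>x. cpow_re k (u x) (a x) 1)"
    using conjunct1[OF Suc] by (rule mpoly_fun_mono) auto
  ultimately show ?case by (auto intro!: mpoly_fun_diff mpoly_fun_add)
qed

lemma continuous_on_mpoly_fun: "mpoly_fun m A f \<Longrightarrow> continuous_on S f"
  unfolding mpoly_fun_def mpoly_eval_def
  by (force intro!: continuous_on_sum continuous_on_mult continuous_on_const continuous_on_prod continuous_on_power continuous_on_coordinate)

lemma polynomial_mapI: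
  assumes "X \<subseteq> topspace (Euclidean_space m)" "Y \<subseteq> topspace (Euclidean_space s)"
    and "\<And>i. i < s \<Longrightarrow> mpoly_fun m UNIV (\<lambda>x. f x i)" and "\<And>x. x \<in> X \<Longrightarrow> f x \<in> Y"
  shows "polynomial_map m X s Y f"
proof -
  have "\<forall>i. \<exists>P. i < s \<longrightarrow> mpoly_in m P \<and> mpoly_eval P = (\<lambda>x. f x i)"
    using assms(3) unfolding mpoly_fun_def by blast
  then obtain F where F: "\<And>i. i < s \<Longrightarrow> mpoly_in m (F i) \<and> mpoly_eval (F i) = (\<lambda>x. f x i)" by metis
  \<comment> \<open>From index \<open>s\<close> on the tuple is 0 by definition, and
    \<open>f x\<close> vanishes there because it lies in \<open>Y\<close>.\<close>
  have "f x = mpoly_tuple_eval s F x" if "x \<in> X" for x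
    using assms(2,4) F that by (force simp: mpoly_tuple_eval_def fun_eq_iff topspace_Euclidean_space subset_iff)
  then show ?thesis using assms F unfolding polynomial_map_def by blast
qed

lemma homogeneous_polynomial_mapI:
  assumes "X \<subseteq> topspace (Euclidean_space m)" "Y \<subseteq> topspace (Euclidean_space s)"
    and "\<And>i. i < s \<Longrightarrow> mpoly_fun m {d} (\<lambda>x. f x i)" and "\<And>x. x \<in> X \<Longrightarrow> f x \<in> Y"
  shows "homogeneous_polynomial_map d m X s Y f"
proof -
  have "\<forall>i. \<exists>P. i < s \<longrightarrow> (mpoly_in m P \<and> mpoly_homogeneous d P) \<and> mpoly_eval P = (\<lambda>x. f x i)"
    using assms(3) unfolding mpoly_fun_def mpoly_homogeneous_def monomial_degree_def by fastforce
  then obtain F where F: "\<And>i. i < s \<Longrightarrow> (mpoly_in m (F i) \<and> mpoly_homogeneous d (F i)) \<and> mpoly_eval (F i) = (\<lambda>x. f x i)" by metis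
  have "f x = mpoly_tuple_eval s F x" if "x \<in> X" for x
    using assms(2,4) F that by (force simp: mpoly_tuple_eval_def fun_eq_iff topspace_Euclidean_space subset_iff)
  then show ?thesis using assms F unfolding homogeneous_polynomial_map_def by blast
qed

section \<open>Joins\<close>

text \<open>The form of degree \<open>K\<close> on the first \<open>q\<close> coordinates that
  extends \<open>power_map K\<close> from the unit sphere: the squared length of the coordinates
  after the first replaces \<open>1 - (x 0)^2\<close>.\<close>

definition power_core :: "nat \<Rightarrow> nat \<Rightarrow> (nat \<Rightarrow> real) \<Rightarrow> nat \<Rightarrow> real" where
  "power_core q K x i =
     (if i = 0 then cpow_re K (\<Sum>j\<in>{1..<q}. (x j)\<^sup>2) (x 0) 1
      else if i < q then cpow_im K (\<Sum>j\<in>{1..<q}. (x j)\<^sup>2) (x 0) 1 * x i else 0)"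

definition join_map ::
    "nat \<Rightarrow> nat \<Rightarrow> ((nat \<Rightarrow> real) \<Rightarrow> real) \<Rightarrow> ((nat \<Rightarrow> real) \<Rightarrow> real) \<Rightarrow> ((nat \<Rightarrow> real) \<Rightarrow> real) \<Rightarrow>
      (nat \<Rightarrow> real) \<Rightarrow> nat \<Rightarrow> real" where
  "join_map q K p s g x i =
     (if i < q then p x * power_core q K x i + s x * quarter_turn (power_core q K x) i else g x * x i)"

lemma sum_power_core:
  assumes "q \<ge> 1"
  shows "(\<Sum>i<q. (power_core q K x i)\<^sup>2) = (\<Sum>i<q. (x i)\<^sup>2) ^ K"
proof -
  have q: "{..<q} = insert 0 {1..<q}" using assms by auto
  let ?u = "\<Sum>j\<in>{1..<q}. (x j)\<^sup>2"
  have "(\<Sum>i<q. (power_core q K x i)\<^sup>2) = (cpow_re K ?u (x 0) 1)\<^sup>2 + (\<Sum>i\<in>{1..<q}. (cpow_im K ?u (x 0) 1)\<^sup>2 * (x i)\<^sup>2)"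
    unfolding q by (simp add: power_core_def power_mult_distrib)
  also have "\<dots> = (cpow_re K ?u (x 0) 1)\<^sup>2 + ?u * (cpow_im K ?u (x 0) 1)\<^sup>2"
    by (simp flip: sum_distrib_left)
  also have "\<dots> = ((x 0)\<^sup>2 + ?u) ^ K" by (simp add: qnorm_cpow)
  also have "(x 0)\<^sup>2 + ?u = (\<Sum>i<q. (x i)\<^sup>2)" unfolding q by simp
  finally show ?thesis .
qed

lemma sum_split_at:
  fixes f :: "nat \<Rightarrow> real"
  assumes "q \<le> n"
  shows "(\<Sum>i\<le>n. f i) = (\<Sum>i<q. f i) + (\<Sum>i\<in>{q..n}. f i)"
proof -
  have "{..n} = {..<q} \<union> {q..n}" using assms by auto
  then show ?thesis by (simp only:) (rule sum.union_disjoint, auto)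
qed

lemma sum_join_map:
  assumes "even q" "q \<ge> 1" "q \<le> n"
  shows "(\<Sum>i\<le>n. (join_map q K p s g x i)\<^sup>2)
       = ((p x)\<^sup>2 + (s x)\<^sup>2) * (\<Sum>i<q. (x i)\<^sup>2) ^ K + (g x)\<^sup>2 * (\<Sum>i\<in>{q..n}. (x i)\<^sup>2)"
proof -
  have q2: "q = 2 * (q div 2)" using assms(1) by simp
  have "(\<Sum>i\<le>n. (join_map q K p s g x i)\<^sup>2)
      = (\<Sum>i<q. (join_map q K p s g x i)\<^sup>2) + (\<Sum>i\<in>{q..n}. (join_map q K p s g x i)\<^sup>2)"
    using assms(3) by (rule sum_split_at)
  also have "(\<Sum>i<q. (join_map q K p s g x i)\<^sup>2)
      = (\<Sum>i<q. (p x * power_core q K x i + s x * quarter_turn (power_core q K x) i)\<^sup>2)"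
    by (simp add: join_map_def)
  also have "\<dots> = ((p x)\<^sup>2 + (s x)\<^sup>2) * (\<Sum>i<q. (x i)\<^sup>2) ^ K"
    using sum_rotation[of "p x" "power_core q K x" "s x" "q div 2"] sum_power_core[OF assms(2), of K x]
    unfolding q2[symmetric] by simp
  also have "(\<Sum>i\<in>{q..n}. (join_map q K p s g x i)\<^sup>2) = (g x)\<^sup>2 * (\<Sum>i\<in>{q..n}. (x i)\<^sup>2)"
    by (simp add: join_map_def power_mult_distrib sum_distrib_left)
  finally show ?thesis .
qed

lemma mpoly_fun_if:
  assumes "b \<Longrightarrow> mpoly_fun m A f" "\<not> b \<Longrightarrow> mpoly_fun m A g"
  shows "mpoly_fun m A (\<lambda>x. if b then f x else g x)"
  using assms by (cases b) auto

lemma mpoly_fun_power_core: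
  assumes "q \<ge> 1" "q \<le> m"
  shows "mpoly_fun m {K} (\<lambda>x. power_core q K x i)"
proof -
  have u: "mpoly_fun m {2} (\<lambda>x. \<Sum>j\<in>{1..<q}. (x j)\<^sup>2)"
    using assms by (intro mpoly_fun_sum_squares) auto
  have a: "mpoly_fun m {1} (\<lambda>x. x 0)" using assms by (intro mpoly_fun_var) auto
  note c = mpoly_fun_cpow[OF u a, of K]
  have "i < m \<Longrightarrow> mpoly_fun m {K} (\<lambda>x. cpow_im K (\<Sum>j\<in>{1..<q}. (x j)\<^sup>2) (x 0) 1 * x i)"
    by (rule mpoly_fun_mult[OF conjunct2[OF c] mpoly_fun_var[of i m "{1}"]]) auto
  then show ?thesis
    unfolding power_core_def using c assms by (intro mpoly_fun_if mpoly_fun_0) auto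
qed

text \<open>\<open>quarter_turn\<close> only permutes coordinates and changes signs, so it preserves
  the degree \<open>K\<close> of the core.\<close>

lemma mpoly_fun_join_map:
  assumes "even q" "q \<ge> 1" "q \<le> m" "i < m"
    and p: "mpoly_fun m A p" and s: "mpoly_fun m A s" and g: "mpoly_fun m B g"
    and C: "\<And>a. a \<in> A \<Longrightarrow> a + K \<in> C" "\<And>b. b \<in> B \<Longrightarrow> b + 1 \<in> C"
  shows "mpoly_fun m C (\<lambda>x. join_map q K p s g x i)"
proof -
  have core: "mpoly_fun m {K} (\<lambda>x. power_core q K x j)" for j
    using assms by (intro mpoly_fun_power_core) auto
  have "mpoly_fun m {K} (\<lambda>x. quarter_turn (power_core q K x) j)" for j
    unfolding quarter_turn_def by (intro mpoly_fun_if mpoly_fun_minus core)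
  note qt = mpoly_fun_mult[OF s this, of C]
  have "mpoly_fun m C (\<lambda>x. p x * power_core q K x i + s x * quarter_turn (power_core q K x) i)"
    using C(1) by (intro mpoly_fun_add mpoly_fun_mult[OF p core] qt) auto
  moreover have "mpoly_fun m C (\<lambda>x. g x * x i)"
    using C(2) assms(4) by (intro mpoly_fun_mult[OF g mpoly_fun_var[of i m "{1}"]]) auto
  ultimately show ?thesis
    unfolding join_map_def by (cases "i < q") auto
qed

lemma nsphere_mono:
  assumes "x \<in> topspace (nsphere m)" "m \<le> n"
  shows "x \<in> topspace (nsphere n)"
proof -
  have "(\<Sum>i\<le>n. (x i)\<^sup>2) = (\<Sum>i\<le>m. (x i)\<^sup>2)"
    using assms by (intro sum.mono_neutral_right) (auto simp: topspace_nsphere)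
  then show ?thesis using assms by (simp add: topspace_nsphere)
qed

text \<open>Every coordinate beyond \<open>p\<close> keeps its sign, so the suspension lemma removes
  these coordinates one at a time. The restricted map stays in the smaller sphere because a zero
  last coordinate is sent to zero.\<close>

lemma degree_iterated_suspension:
  assumes F: "continuous_map (nsphere n) (nsphere n) F" and p: "p \<le> n"
    and scale: "\<And>x i. \<lbrakk>x \<in> topspace (nsphere n); i > p\<rbrakk> \<Longrightarrow> F x i = g x * x i"
    and pos: "\<And>x. x \<in> topspace (nsphere n) \<Longrightarrow> g x > 0"
  shows "Brouwer_degree2 n F = Brouwer_degree2 p F"
  using p F scale pos
proof (induction n rule: dec_induct)
  case base
  then show ?case by simp
next
  case (step n)
  have "Brouwer_degree2 (Suc n) F = Brouwer_degree2 n F"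
  proof (rule Brouwer_degree2_suspension[OF step.prems(1)])
    fix x assume x: "x \<in> topspace (nsphere (Suc n))"
    have "F x (Suc n) = g x * x (Suc n)" using step.prems(2)[OF x] step.hyps by simp
    then show "0 \<le> x (Suc n) \<Longrightarrow> 0 \<le> F x (Suc n)" "x (Suc n) \<le> 0 \<Longrightarrow> F x (Suc n) \<le> 0"
      using step.prems(3)[OF x] by (auto simp: mult_nonneg_nonpos)
  qed
  moreover have "continuous_map (nsphere n) (nsphere n) F"
    unfolding continuous_map_nsphere_iff
  proof
    have "topspace (nsphere n) \<subseteq> topspace (nsphere (Suc n))" using nsphere_mono by fastforce
    then show "continuous_on (topspace (nsphere n)) F"
      using step.prems(1) continuous_on_subset unfolding continuous_map_nsphere_iff by blast
    show "F \<in> topspace (nsphere n) \<rightarrow> topspace (nsphere n)"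
    proof
      fix x assume x: "x \<in> topspace (nsphere n)"
      then have x': "x \<in> topspace (nsphere (Suc n))" using nsphere_mono by fastforce
      then have Fx: "F x \<in> topspace (nsphere (Suc n))"
        using step.prems(1) unfolding continuous_map_nsphere_iff by blast
      have "F x (Suc n) = 0"
        using step.prems(2)[OF x'] step.hyps x by (simp add: topspace_nsphere)
      then show "F x \<in> topspace (nsphere n)"
        using Fx by (auto simp: topspace_nsphere) (metis Suc_lessI)
    qed
  qed
  moreover have "Brouwer_degree2 n F = Brouwer_degree2 p F"
  proof (rule step.IH)
    show "continuous_map (nsphere n) (nsphere n) F" by fact
  qed (use step.prems nsphere_mono in fastforce)+
  ultimately show ?case by simp
qed

text \<open>Suspensions reduce to the sphere of odd dimension \<open>q - 1\<close>, where
  \<open>F\<close> is the power map followed by multiplication by the unit complex number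
  \<open>c + i d\<close>.\<close>

lemma degree_join:
  assumes F: "continuous_map (nsphere n) (nsphere n) F" and q: "even q" "q \<ge> 1" "q \<le> n"
    and scale: "\<And>x i. \<lbrakk>x \<in> topspace (nsphere n); i \<ge> q\<rbrakk> \<Longrightarrow> F x i = g x * x i"
    and pos: "\<And>x. x \<in> topspace (nsphere n) \<Longrightarrow> g x > 0"
    and base: "\<And>x i. \<lbrakk>x \<in> topspace (nsphere (q - 1)); i < q\<rbrakk> \<Longrightarrow>
        F x i = c * power_core q K x i + d * quarter_turn (power_core q K x) i"
    and cd: "c\<^sup>2 + d\<^sup>2 = 1"
  shows "Brouwer_degree2 n F = int K"
proof -
  let ?p = "q - 1"
  have odd: "odd ?p" using q by simp
  have "Brouwer_degree2 n F = Brouwer_degree2 ?p F"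
    using q by (intro degree_iterated_suspension[OF F, where g = g] scale pos) auto
  also have "\<dots> = Brouwer_degree2 ?p (\<lambda>x i. c * power_map K x i + d * quarter_turn (power_map K x) i)"
  proof (rule Brouwer_degree2_eq)
    fix x assume x: "x \<in> topspace (nsphere ?p)"
    have xn: "x \<in> topspace (nsphere n)" using nsphere_mono[OF x] q by simp
    have pm: "power_map K x \<in> topspace (nsphere ?p)"
      using x continuous_map_power_map[of ?p K] unfolding continuous_map_nsphere_iff by blast
    have "{1..<q} = {1..?p}" using q by auto
    then have u: "(\<Sum>j\<in>{1..<q}. (x j)\<^sup>2) = 1 - (x 0)\<^sup>2" using nsphere_split_0[OF x] by simp
    have core: "power_core q K x = power_map K x"
      using x q unfolding power_core_def power_map_def latitude_def u by (auto simp: fun_eq_iff topspace_nsphere)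
    show "F x = (\<lambda>i. c * power_map K x i + d * quarter_turn (power_map K x) i)"
    proof
      fix i
      show "F x i = c * power_map K x i + d * quarter_turn (power_map K x) i"
      proof (cases "i < q")
        case True
        then show ?thesis using base[OF x] core by simp
      next
        case False
        then have i: "i > ?p" using q by simp
        then have "x i = 0" "power_map K x i = 0" using x pm by (auto simp: topspace_nsphere)
        then show ?thesis using scale[OF xn, of i] False quarter_turn_tail[OF odd pm i] by simp
      qed
    qed
  qed
  also have "\<dots> = int K"
    using degree_rotation[OF odd continuous_map_power_map cd] degree_power_map[OF odd] by simp
  finally show ?thesis .
qed

lemma continuous_on_join_map:
  assumes "even q" "q \<ge> 1" "q \<le> Suc n" "\<And>x i. \<lbrakk>x \<in> X; i > n\<rbrakk> \<Longrightarrow> x i = 0"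
    and "mpoly_fun (Suc n) UNIV p" "mpoly_fun (Suc n) UNIV s" "mpoly_fun (Suc n) UNIV g"
  shows "continuous_on X (join_map q K p s g)"
proof (rule continuous_on_coordinatewise_then_product)
  fix i
  show "continuous_on X (\<lambda>x. join_map q K p s g x i)"
  proof (cases "i < Suc n")
    case True
    show ?thesis
      by (rule continuous_on_mpoly_fun[OF mpoly_fun_join_map[OF assms(1,2,3) True assms(5-7), of K UNIV]]) auto
  next
    case False
    then have "join_map q K p s g x i = 0" if "x \<in> X" for x
      using that assms(3,4) by (simp add: join_map_def)
    then show ?thesis by (simp cong: continuous_on_cong)
  qed
qed

section \<open>Reflection in the first coordinate, which supplies the negative degrees\<close>

definition reflect_0 :: "(nat \<Rightarrow> real) \<Rightarrow> nat \<Rightarrow> real" where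
  "reflect_0 x = (\<lambda>i. if i = 0 then - x i else x i)"

lemma continuous_map_reflect_0: "continuous_map (nsphere n) (nsphere n) reflect_0"
  using continuous_map_nsphere_reflection[of n 0] by (simp add: reflect_0_def[abs_def])

lemma degree_reflect_0_compose:
  "continuous_map (nsphere n) (nsphere n) F \<Longrightarrow> Brouwer_degree2 n (reflect_0 \<circ> F) = - Brouwer_degree2 n F"
  using Brouwer_degree2_compose[OF _ continuous_map_reflect_0] Brouwer_degree2_reflection[of n]
  by (simp add: reflect_0_def[abs_def])

lemma mpoly_fun_reflect_0:
  "mpoly_fun m A (\<lambda>x. F x i) \<Longrightarrow> mpoly_fun m A (\<lambda>x. (reflect_0 \<circ> F) x i)"
  unfolding reflect_0_def comp_def by (intro mpoly_fun_if mpoly_fun_minus)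

text \<open>The degrees balance: \<open>p\<close> and \<open>s\<close> have degree m - 1 and the
  core has degree m, while \<open>G\<close> has degree 2(m - 1) and multiplies a coordinate. Oddness
  of \<open>m\<close> makes \<open>v\<close> positive on the whole line, hence a sum of two squares
  in the same variable.\<close>

lemma homogeneous_map_degree_odd:
  assumes n: "n \<ge> 2" and m: "odd m"
  obtains f where "\<And>i. i < Suc n \<Longrightarrow> mpoly_fun (Suc n) {2 * m - 1} (\<lambda>x. f x i)"
    "continuous_map (nsphere n) (nsphere n) f" "Brouwer_degree2 n f = int m"
proof -
  have m1: "m \<ge> 1" using m by (cases m) auto
  obtain g v :: "real poly" where gv: "1 - [:0, 1:] * g\<^sup>2 = [:1, -1:] ^ m * v" "degree g \<le> m - 1" "degree v \<le> m - 1"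
    and gpos: "\<forall>x\<le>1. poly g x > 0" and vpos: "\<forall>x. poly v x > 0"
    using flat_polynomial[OF m1] m by blast
  obtain P Q where v: "v = P\<^sup>2 + Q\<^sup>2" using pos_poly_sum_two_squares vpos by blast
  \<comment> \<open>\<open>v\<close> has degree at most the even number m - 1, so \<open>P\<close>
    and \<open>Q\<close> have degree at most \<open>e\<close>; homogenizing them with quadratic
    forms gives degree 2 e = m - 1.\<close>
  define e where "e = (m - 1) div 2"
  have e: "2 * e = m - 1" using m by (simp add: e_def)
  have dP: "degree P \<le> e" and dQ: "degree Q \<le> e"
    using degree_sum_two_squares[of P Q] degree_sum_two_squares[of Q P] gv(3) e v by (auto simp: add.commute)
  define w where "w x = (\<Sum>i\<in>{2..n}. (x i)\<^sup>2)" for x :: "nat \<Rightarrow> real"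
  define N where "N x = (\<Sum>i\<in>{..n}. (x i)\<^sup>2)" for x :: "nat \<Rightarrow> real"
  have w2: "mpoly_fun (Suc n) {2} w" and N2: "mpoly_fun (Suc n) {2} N"
    unfolding w_def N_def by (intro mpoly_fun_sum_squares; auto)+
  define p where "p x = homogenize e P (w x) (N x)" for x
  define s where "s x = homogenize e Q (w x) (N x)" for x
  define G where "G x = homogenize (m - 1) g (w x) (N x)" for x
  have ph: "mpoly_fun (Suc n) {m - 1} p" "mpoly_fun (Suc n) {m - 1} s" "mpoly_fun (Suc n) {2 * (m - 1)} G"
    unfolding p_def s_def G_def using mpoly_fun_homogenize[OF w2 N2, of e] mpoly_fun_homogenize[OF w2 N2, of "m - 1" g]
    by (auto simp: e)
  let ?f = "join_map 2 m p s G"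
  have hom: "mpoly_fun (Suc n) {2 * m - 1} (\<lambda>x. ?f x i)" if "i < Suc n" for i
    using n m1 that by (intro mpoly_fun_join_map[OF _ _ _ _ ph]) auto
  have on: "p x = poly P (w x) \<and> s x = poly Q (w x) \<and> G x = poly g (w x) \<and> w x \<le> 1 \<and> (\<Sum>i<2. (x i)\<^sup>2) = 1 - w x"
    if x: "x \<in> topspace (nsphere n)" for x
  proof -
    have N1: "N x = 1" using x by (simp add: N_def topspace_nsphere)
    have "N x = (\<Sum>i<2. (x i)\<^sup>2) + w x"
      unfolding N_def w_def using n by (rule sum_split_at)
    moreover have "(\<Sum>i<2. (x i)\<^sup>2) \<ge> 0" by (intro sum_nonneg) auto
    ultimately show ?thesis
      using N1 dP dQ gv(2) by (simp add: p_def s_def G_def homogenize_1)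
  qed
  have id: "(1 - y) ^ m * ((poly P y)\<^sup>2 + (poly Q y)\<^sup>2) + y * (poly g y)\<^sup>2 = 1" for y
    using arg_cong[OF gv(1), of "\<lambda>p. poly p y"] by (simp add: v poly_power)
  have fS: "?f x \<in> topspace (nsphere n)" if x: "x \<in> topspace (nsphere n)" for x
  proof -
    have "(\<Sum>i\<le>n. (?f x i)\<^sup>2) = 1"
      using sum_join_map[of 2 n m p s G x] n on[OF x] id[of "w x"] by (simp add: w_def[symmetric] mult.commute)
    moreover have "?f x i = 0" if "i > n" for i
      using that n x by (simp add: join_map_def topspace_nsphere)
    ultimately show ?thesis by (simp add: topspace_nsphere)
  qed
  have cf: "continuous_map (nsphere n) (nsphere n) ?f"
    unfolding continuous_map_nsphere_iff
    using fS n mpoly_fun_mono[OF ph(1)] mpoly_fun_mono[OF ph(2)] mpoly_fun_mono[OF ph(3)]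
    by (auto intro!: continuous_on_join_map[of 2 n] simp: topspace_nsphere)
  have "Brouwer_degree2 n ?f = int m"
  \<comment> \<open>On the circle the remaining coordinates vanish, so \<open>w = 0\<close>, and the
    complex factor is the constant with parts P(0) and Q(0).\<close>
  proof (rule degree_join[OF cf, where q = 2 and g = G and c = "poly P 0" and d = "poly Q 0"])
    show "?f x i = G x * x i" if "2 \<le> i" for x i using that by (simp add: join_map_def)
    show "G x > 0" if "x \<in> topspace (nsphere n)" for x using on[OF that] gpos by simp
    show "(poly P 0)\<^sup>2 + (poly Q 0)\<^sup>2 = 1" using id[of 0] by simp
    show "?f x i = poly P 0 * power_core 2 m x i + poly Q 0 * quarter_turn (power_core 2 m x) i"
      if x: "x \<in> topspace (nsphere (2 - 1))" and i: "i < 2" for x i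
    proof -
      have "w x = 0" using x by (simp add: w_def topspace_nsphere)
      then show ?thesis using on[of x] nsphere_mono[OF x, of n] n i by (simp add: join_map_def)
    qed
  qed (use n in auto)
  then show thesis using that hom cf by blast
qed

section \<open>The quartic hypersurface\<close>

text \<open>\<open>quartic_scale q x\<close> is the positive root \<open>\<lambda>\<close> of \<open>(\<lambda>\<^sup>2 a)\<^sup>2 + \<lambda>\<^sup>2 (1 - a) = 1\<close>. On the unit sphere
  \<open>1 - a\<close> is the squared norm of the remaining coordinates; writing \<open>1 - a\<close> for it keeps the
  denominator away from \<open>0\<close> at the origin.\<close>

definition quartic_scale :: "nat \<Rightarrow> (nat \<Rightarrow> real) \<Rightarrow> real" where
  "quartic_scale q x = (let a = (\<Sum>i<q. (x i)\<^sup>2) in sqrt (2 / ((1 - a) + sqrt ((1 - a)\<^sup>2 + 4 * a\<^sup>2))))"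

definition to_quartic :: "nat \<Rightarrow> (nat \<Rightarrow> real) \<Rightarrow> nat \<Rightarrow> real" where
  "to_quartic q x = (\<lambda>i. quartic_scale q x * x i)"

lemma quartic_scale_denom_pos: "(1 - a) + sqrt ((1 - a)\<^sup>2 + 4 * a\<^sup>2) > 0" for a :: real
proof (cases "a = 0")
  case False
  have "\<bar>1 - a\<bar> = sqrt ((1 - a)\<^sup>2)" by simp
  also have "\<dots> < sqrt ((1 - a)\<^sup>2 + 4 * a\<^sup>2)" using False by (subst real_sqrt_less_iff) simp
  finally show ?thesis by linarith
qed simp

lemma quartic_scale_pos: "quartic_scale q x > 0"
  unfolding quartic_scale_def Let_def using quartic_scale_denom_pos by simp

lemma quartic_scale_eq:
  fixes x :: "nat \<Rightarrow> real" and q :: nat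
  defines "a \<equiv> \<Sum>i<q. (x i)\<^sup>2"
  shows "((quartic_scale q x)\<^sup>2 * a)\<^sup>2 + (quartic_scale q x)\<^sup>2 * (1 - a) = 1"
proof -
  define S where "S = sqrt ((1 - a)\<^sup>2 + 4 * a\<^sup>2)"
  define D where "D = (1 - a) + S"
  have D: "D > 0" unfolding D_def S_def by (rule quartic_scale_denom_pos)
  have S2: "S\<^sup>2 = (1 - a)\<^sup>2 + 4 * a\<^sup>2" by (simp add: S_def)
  have L: "(quartic_scale q x)\<^sup>2 = 2 / D"
    using D by (simp add: quartic_scale_def Let_def D_def S_def a_def)
  \<comment> \<open>The squared scale is 2 / D, and this quadratic equation for \<open>D\<close> is
    the defining equation of the scale with denominators cleared.\<close>
  have "D\<^sup>2 = 2 * (1 - a) * D + 4 * a\<^sup>2"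
    using S2 by (simp add: D_def power2_eq_square algebra_simps)
  moreover have "(2 / D * a)\<^sup>2 + 2 / D * (1 - a) = (2 * (1 - a) * D + 4 * a\<^sup>2) / D\<^sup>2"
    using D by (simp add: field_simps power2_eq_square)
  ultimately have "(2 / D * a)\<^sup>2 + 2 / D * (1 - a) = D\<^sup>2 / D\<^sup>2" by (simp only:)
  then show ?thesis
    unfolding L using D by simp
qed

lemma quartic_scale_1:
  assumes "(\<Sum>i<q. (x i)\<^sup>2) = 1"
  shows "quartic_scale q x = 1"
  using assms by (simp add: quartic_scale_def Let_def)

lemma continuous_on_to_quartic: "continuous_on X (to_quartic q)"
proof (rule continuous_on_coordinatewise_then_product)
  fix i
  have a: "continuous_on X (\<lambda>x. \<Sum>i<q. (x i)\<^sup>2)"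
    by (intro continuous_on_sum continuous_on_power continuous_on_coordinate)
  have "continuous_on X (quartic_scale q)"
    unfolding quartic_scale_def Let_def
    by (intro continuous_on_real_sqrt continuous_on_divide continuous_on_add continuous_on_diff continuous_on_const
        continuous_on_mult continuous_on_power a) (use quartic_scale_denom_pos in \<open>metis less_irrefl\<close>)
  then show "continuous_on X (\<lambda>x. to_quartic q x i)"
    unfolding to_quartic_def by (intro continuous_on_mult continuous_on_coordinate)
qed

lemma to_quartic_sums:
  "(\<Sum>i<q. (to_quartic q x i)\<^sup>2) = (quartic_scale q x)\<^sup>2 * (\<Sum>i<q. (x i)\<^sup>2)"
  "(\<Sum>i\<in>{q..n}. (to_quartic q x i)\<^sup>2) = (quartic_scale q x)\<^sup>2 * (\<Sum>i\<in>{q..n}. (x i)\<^sup>2)"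
  by (simp_all add: to_quartic_def power_mult_distrib sum_distrib_left)

lemma to_quartic_sphere:
  assumes "q \<le> n" "x \<in> topspace (nsphere n)"
  shows "to_quartic q x \<in> quartic_sphere n q"
proof -
  have "(\<Sum>i\<in>{q..n}. (x i)\<^sup>2) = 1 - (\<Sum>i<q. (x i)\<^sup>2)"
    using assms sum_split_at[OF assms(1), of "\<lambda>i. (x i)\<^sup>2"] by (simp add: topspace_nsphere)
  then show ?thesis
    using quartic_scale_eq[of q x] assms(2)
    by (simp add: quartic_sphere_def to_quartic_sums topspace_Euclidean_space topspace_nsphere Suc_le_eq)
      (simp add: to_quartic_def)
qed

text \<open>Inside the ball \<open>1 - a\<close> is at least the squared norm of the remaining
  coordinates, so the equation for the scale becomes an inequality.\<close>

lemma to_quartic_ball: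
  assumes "q \<le> n" "x \<in> closed_unit_ball n"
  shows "to_quartic q x \<in> quartic_ball n q \<union> quartic_sphere n q"
proof -
  let ?L = "(quartic_scale q x)\<^sup>2" and ?a = "\<Sum>i<q. (x i)\<^sup>2"
  have "(\<Sum>i\<in>{q..n}. (x i)\<^sup>2) \<le> 1 - ?a"
    using assms sum_split_at[OF assms(1), of "\<lambda>i. (x i)\<^sup>2"] by (simp add: closed_unit_ball)
  then have "?L * (\<Sum>i\<in>{q..n}. (x i)\<^sup>2) \<le> ?L * (1 - ?a)"
    by (intro mult_left_mono) auto
  then have "(?L * ?a)\<^sup>2 + ?L * (\<Sum>i\<in>{q..n}. (x i)\<^sup>2) \<le> 1"
    using quartic_scale_eq[of q x] by linarith
  moreover have "to_quartic q x \<in> topspace (Euclidean_space (Suc n))"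
    using assms(2) by (simp add: topspace_Euclidean_space closed_unit_ball to_quartic_def)
  ultimately show ?thesis
    by (auto simp: quartic_ball_def quartic_sphere_def to_quartic_sums)
qed

text \<open>The quartic expression does not increase when a point is shrunk towards the origin,
  which gives \<open>star\<close>. Moreover \<open>to_quartic\<close> moves points along their rays
  by a positive factor, so the linear homotopy to the identity never vanishes on the sphere.\<close>

lemma quartic_degree:
  assumes n: "n \<ge> 1" "q \<le> n" and f: "continuous_on (quartic_sphere n q) f"
    "f \<in> quartic_sphere n q \<rightarrow> topspace (nsphere n)"
  shows "has_Brouwer_degree n (quartic_ball n q) (quartic_sphere n q) (unit_ball n) (topspace (nsphere n)) f
           (Brouwer_degree2 n (f \<circ> to_quartic q))"
proof (rule has_Brouwer_degree_pullback[OF n(1) _ _ _ _ _ _ _ f])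
  show "x \<noteq> (\<lambda>i. s * p i)" if p: "p \<in> quartic_ball n q" and s: "s \<in> {0..1}" and x: "x \<in> quartic_sphere n q" for p s x
  proof
    assume eq: "x = (\<lambda>i. s * p i)"
    let ?A = "\<Sum>i<q. (p i)\<^sup>2" and ?B = "\<Sum>i\<in>{q..n}. (p i)\<^sup>2"
    have nn: "?A \<ge> 0" "?B \<ge> 0" by (intro sum_nonneg; simp)+
    have "1 = (s\<^sup>2 * ?A)\<^sup>2 + s\<^sup>2 * ?B"
      using x by (simp add: eq quartic_sphere_def power_mult_distrib flip: sum_distrib_left)
    also have "\<dots> \<le> ?A\<^sup>2 + ?B"
      using s nn by (intro add_mono power_mono mult_left_le_one_le) (auto simp: power_le_one)
    also have "\<dots> < 1" using p by (simp add: quartic_ball_def)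
    finally show False by simp
  qed
  show "(\<lambda>i. (1 - s) * to_quartic q x i + s * x i) \<noteq> (\<lambda>i. 0)" if s: "s \<in> {0..1}" and x: "x \<in> topspace (nsphere n)" for s x
  proof
    assume eq: "(\<lambda>i. (1 - s) * to_quartic q x i + s * x i) = (\<lambda>i. 0)"
    have "(1 - s) * quartic_scale q x + s > 0"
      using s quartic_scale_pos[of q x] by (cases "s = 0") (auto intro: add_nonneg_pos)
    moreover have "((1 - s) * quartic_scale q x + s) * x i = 0" for i
      using fun_cong[OF eq, of i] by (simp add: to_quartic_def algebra_simps)
    ultimately have "x i = 0" for i by (metis less_irrefl mult_eq_0_iff)
    then show False using x by (simp add: topspace_nsphere)
  qed
qed (use n to_quartic_ball to_quartic_sphere in \<open>auto simp: continuous_on_to_quartic quartic_ball_def quartic_sphere_def\<close>)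

text \<open>With u = |z|^2 the hypersurface satisfies u^2 = 1 - w. The core of degree 2 m has
  squared norm u^(2m) = (1 - w)^m, exactly the factor in the identity for \<open>g\<close> and
  \<open>v\<close>; this is why the Brouwer degree is even.\<close>

lemma polynomial_map_degree_even:
  assumes n: "q \<le> n" and q: "even q" "q \<ge> 1" and m: "m \<ge> 1"
  obtains f where "\<And>i. i < Suc n \<Longrightarrow> mpoly_fun (Suc n) UNIV (\<lambda>x. f x i)"
    "continuous_on (quartic_sphere n q) f" "f \<in> quartic_sphere n q \<rightarrow> topspace (nsphere n)"
    "Brouwer_degree2 n (f \<circ> to_quartic q) = 2 * int m"
proof -
  obtain g v :: "real poly" where gv: "1 - [:0, 1:] * g\<^sup>2 = [:1, -1:] ^ m * v"
    and gpos: "\<forall>x\<le>1. poly g x > 0" and vpos: "\<forall>x\<le>1. poly v x > 0"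
    using flat_polynomial[OF m] by blast
  \<comment> \<open>The substitution 1 - x^2 takes only values at most 1, where \<open>v\<close> is
    positive for every \<open>m\<close>, even or odd.\<close>
  have "poly (pcompose v [:1, 0, -1:]) x > 0" for x
    using vpos by (simp add: poly_pcompose)
  then obtain P Q where PQ: "pcompose v [:1, 0, -1:] = P\<^sup>2 + Q\<^sup>2" using pos_poly_sum_two_squares by blast
  have vPQ: "poly v (1 - x\<^sup>2) = (poly P x)\<^sup>2 + (poly Q x)\<^sup>2" for x
    using arg_cong[OF PQ, of "\<lambda>p. poly p x"] by (simp add: poly_pcompose power2_eq_square)
  define u where "u x = (\<Sum>i<q. (x i)\<^sup>2)" for x :: "nat \<Rightarrow> real"
  define w where "w x = (\<Sum>i\<in>{q..n}. (x i)\<^sup>2)" for x :: "nat \<Rightarrow> real"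
  have u2: "mpoly_fun (Suc n) UNIV u" and w2: "mpoly_fun (Suc n) UNIV w"
    unfolding u_def w_def using n by (auto intro!: mpoly_fun_mono[OF mpoly_fun_sum_squares])
  define p where "p x = poly P (u x)" for x
  define s where "s x = poly Q (u x)" for x
  define G where "G x = poly g (w x)" for x
  have ph: "mpoly_fun (Suc n) UNIV p" "mpoly_fun (Suc n) UNIV s" "mpoly_fun (Suc n) UNIV G"
    unfolding p_def s_def G_def by (intro mpoly_fun_poly u2 w2)+
  let ?f = "join_map q (2 * m) p s G"
  have poly: "mpoly_fun (Suc n) UNIV (\<lambda>x. ?f x i)" if "i < Suc n" for i
    using n q that by (intro mpoly_fun_join_map[OF _ _ _ _ ph]) auto
  have on: "(u x)\<^sup>2 = 1 - w x" "w x \<le> 1" if x: "x \<in> quartic_sphere n q" for x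
  proof -
    have "(u x)\<^sup>2 + w x = 1" using x by (simp add: quartic_sphere_def u_def w_def)
    then show "(u x)\<^sup>2 = 1 - w x" "w x \<le> 1" by (simp_all, metis le_add_same_cancel2 zero_le_power2)
  qed
  have id: "(1 - y) ^ m * poly v y + y * (poly g y)\<^sup>2 = 1" for y
    using arg_cong[OF gv, of "\<lambda>p. poly p y"] by (simp add: poly_power)
  have unit: "((p x)\<^sup>2 + (s x)\<^sup>2) * (u x) ^ (2 * m) + (G x)\<^sup>2 * w x = 1" if x: "x \<in> quartic_sphere n q" for x
  proof -
    have "(p x)\<^sup>2 + (s x)\<^sup>2 = poly v (w x)"
      using vPQ[of "u x"] on(1)[OF x] by (simp add: p_def s_def)
    moreover have "(u x) ^ (2 * m) = (1 - w x) ^ m" using on(1)[OF x] by (simp add: power_mult)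
    ultimately show ?thesis using id[of "w x"] by (simp add: G_def mult.commute)
  qed
  have fS: "?f x \<in> topspace (nsphere n)" if x: "x \<in> quartic_sphere n q" for x
  proof -
    have "(\<Sum>i\<le>n. (?f x i)\<^sup>2) = 1"
      using sum_join_map[OF q n, of "2 * m" p s G x] unit[OF x] by (simp add: w_def u_def)
    moreover have "?f x i = 0" if "i > n" for i
      using that n x by (simp add: join_map_def quartic_sphere_def topspace_Euclidean_space)
    ultimately show ?thesis by (simp add: topspace_nsphere)
  qed
  have cf: "continuous_on (quartic_sphere n q) ?f"
    using n by (intro continuous_on_join_map[OF q _ _ ph]) (auto simp: quartic_sphere_def topspace_Euclidean_space)
  have hS: "to_quartic q x \<in> quartic_sphere n q" if "x \<in> topspace (nsphere n)" for x
    using to_quartic_sphere[OF n that] .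
  have "continuous_on (topspace (nsphere n)) (?f \<circ> to_quartic q)"
    using hS by (intro continuous_on_compose continuous_on_to_quartic continuous_on_subset[OF cf]) auto
  then have cfh: "continuous_map (nsphere n) (nsphere n) (?f \<circ> to_quartic q)"
    unfolding continuous_map_nsphere_iff using fS hS by auto
  have "Brouwer_degree2 n (?f \<circ> to_quartic q) = int (2 * m)"
  \<comment> \<open>On the sphere of the first \<open>q\<close> coordinates u = 1 and
    \<open>to_quartic\<close> is the identity, so the complex factor is the constant with parts P(1)
    and Q(1).\<close>
  proof (rule degree_join[OF cfh q n, where g = "\<lambda>x. G (to_quartic q x) * quartic_scale q x" and c = "poly P 1" and d = "poly Q 1"])
    show "(?f \<circ> to_quartic q) x i = G (to_quartic q x) * quartic_scale q x * x i" if "q \<le> i" for x i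
      using that by (simp add: join_map_def to_quartic_def)
    show "G (to_quartic q x) * quartic_scale q x > 0" if "x \<in> topspace (nsphere n)" for x
      using gpos on(2)[OF hS[OF that]] quartic_scale_pos[of q x] by (simp add: G_def)
    show "(poly P 1)\<^sup>2 + (poly Q 1)\<^sup>2 = 1" using vPQ[of 1] id[of 0] by simp
    show "(?f \<circ> to_quartic q) x i = poly P 1 * power_core q (2 * m) x i + poly Q 1 * quarter_turn (power_core q (2 * m) x) i"
      if x: "x \<in> topspace (nsphere (q - 1))" and i: "i < q" for x i
    proof -
      have "{..<q} = {..q - 1}" using q by auto
      then have u1: "u x = 1" using x by (simp add: u_def topspace_nsphere)
      then have "to_quartic q x = x" by (simp add: to_quartic_def quartic_scale_1 u_def)
      then show ?thesis using u1 i by (simp add: join_map_def p_def s_def)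
    qed
  qed
  then show thesis using that[of ?f] poly cf fS by auto
qed

theorem theorem1:
  fixes n :: nat and k :: int
  assumes "n \<ge> 2" and "even n"
  shows "(odd k \<longrightarrow>
            (\<exists>f. homogeneous_polynomial_map (nat (2 * \<bar>k\<bar> - 1))
                   (Suc n) (topspace (nsphere n)) (Suc n) (topspace (nsphere n)) f \<and>
                 Brouwer_degree2 n f = k)) \<and>
         (even k \<longrightarrow>
            (\<forall>r::nat. 2 \<le> 2 * r \<and> 2 * r \<le> n \<longrightarrow>
               (\<exists>f. polynomial_map (Suc n) (quartic_sphere n (2 * r)) (Suc n) (topspace (nsphere n)) f \<and>
                    has_Brouwer_degree n (quartic_ball n (2 * r)) (quartic_sphere n (2 * r))
                      (unit_ball n) (topspace (nsphere n)) f k)))"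
proof (intro conjI impI allI)
  assume k: "odd k"
  define m where "m = nat \<bar>k\<bar>"
  have m: "odd m" using k by (simp add: m_def even_nat_iff)
  obtain f where f: "\<And>i. i < Suc n \<Longrightarrow> mpoly_fun (Suc n) {2 * m - 1} (\<lambda>x. f x i)"
    "continuous_map (nsphere n) (nsphere n) f" "Brouwer_degree2 n f = int m"
    using homogeneous_map_degree_odd[OF assms(1) m] by metis
  \<comment> \<open>For negative \<open>k\<close> the reflection negates the Brouwer degree and
    keeps the algebraic degree.\<close>
  define F where "F = (if k \<ge> 0 then f else reflect_0 \<circ> f)"
  have cF: "continuous_map (nsphere n) (nsphere n) F"
    using f(2) continuous_map_compose[OF f(2) continuous_map_reflect_0] by (simp add: F_def)
  \<comment> \<open>Here |k| is at least 1 because \<open>k\<close> is odd, so neither subtraction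
    is truncated.\<close>
  have "nat (2 * \<bar>k\<bar> - 1) = 2 * m - 1" by (simp add: m_def nat_diff_distrib nat_mult_distrib)
  moreover have "homogeneous_polynomial_map (2 * m - 1) (Suc n) (topspace (nsphere n)) (Suc n) (topspace (nsphere n)) F"
  proof (rule homogeneous_polynomial_mapI)
    show "mpoly_fun (Suc n) {2 * m - 1} (\<lambda>x. F x i)" if "i < Suc n" for i
      using f(1)[OF that] mpoly_fun_reflect_0[of "Suc n" _ f i] by (simp add: F_def)
    show "F x \<in> topspace (nsphere n)" if "x \<in> topspace (nsphere n)" for x
      using cF that unfolding continuous_map_nsphere_iff by blast
  qed (rule nsphere_subset)+
  moreover have "Brouwer_degree2 n F = k"
    using f(3) degree_reflect_0_compose[OF f(2)] by (simp add: F_def m_def)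
  ultimately show "\<exists>f. homogeneous_polynomial_map (nat (2 * \<bar>k\<bar> - 1))
                   (Suc n) (topspace (nsphere n)) (Suc n) (topspace (nsphere n)) f \<and> Brouwer_degree2 n f = k"
    by auto
next
  fix r :: nat
  assume k: "even k" and r: "2 \<le> 2 * r \<and> 2 * r \<le> n"
  let ?q = "2 * r"
  let ?M = "quartic_sphere n ?q"
  have q: "?q \<le> n" "even ?q" "?q \<ge> 1" using r by auto
  have "\<exists>f. (\<forall>i<Suc n. mpoly_fun (Suc n) UNIV (\<lambda>x. f x i)) \<and> continuous_on ?M f \<and>
      f \<in> ?M \<rightarrow> topspace (nsphere n) \<and> Brouwer_degree2 n (f \<circ> to_quartic ?q) = k"
  proof (cases "k = 0")
    case True
    \<comment> \<open>The joins only give degrees of absolute value 2 m with m >= 1; degree 0 is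
      realized by a constant map.\<close>
    let ?e = "(\<lambda>i. if i = 0 then 1 else 0) :: nat \<Rightarrow> real"
    have "Brouwer_degree2 n ((\<lambda>x. ?e) \<circ> to_quartic ?q) = k"
      using True Brouwer_degree2_const[of n ?e] by (simp add: comp_def)
    then show ?thesis
      using in_topspace_nsphere[of n]
      by (intro exI[of _ "\<lambda>x. ?e"]) (auto intro!: mpoly_fun_const)
  next
    case False
    define m where "m = nat \<bar>k\<bar> div 2"
    have "even (nat \<bar>k\<bar>)" using k by (simp add: even_nat_iff)
    then have m2: "2 * int m = \<bar>k\<bar>" unfolding m_def by (metis dvd_mult_div_cancel int_nat_eq abs_ge_zero of_nat_mult of_nat_numeral)
    then have "m \<ge> 1" using False by (cases m) auto
    then obtain f where f: "\<And>i. i < Suc n \<Longrightarrow> mpoly_fun (Suc n) UNIV (\<lambda>x. f x i)"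
      "continuous_on ?M f" "f \<in> ?M \<rightarrow> topspace (nsphere n)" "Brouwer_degree2 n (f \<circ> to_quartic ?q) = 2 * int m"
      using polynomial_map_degree_even[OF q] by metis
    have hS: "to_quartic ?q x \<in> ?M" if "x \<in> topspace (nsphere n)" for x
      using to_quartic_sphere[OF q(1) that] .
    have cfh: "continuous_map (nsphere n) (nsphere n) (f \<circ> to_quartic ?q)"
      unfolding continuous_map_nsphere_iff
    proof
      show "continuous_on (topspace (nsphere n)) (f \<circ> to_quartic ?q)"
        using hS by (intro continuous_on_compose continuous_on_to_quartic continuous_on_subset[OF f(2)]) auto
    qed (use f(3) hS in auto)
    define F where "F = (if k \<ge> 0 then f else reflect_0 \<circ> f)"
    have refl: "continuous_on (topspace (nsphere n)) reflect_0" "reflect_0 \<in> topspace (nsphere n) \<rightarrow> topspace (nsphere n)"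
      using continuous_map_reflect_0[of n] unfolding continuous_map_nsphere_iff by auto
    have "\<forall>i<Suc n. mpoly_fun (Suc n) UNIV (\<lambda>x. F x i)"
      using f(1) mpoly_fun_reflect_0[of "Suc n" UNIV f] by (simp add: F_def)
    moreover have "continuous_on ?M F"
      using f(2,3) continuous_on_compose2[OF refl(1) f(2)] by (auto simp: F_def comp_def)
    moreover have "F \<in> ?M \<rightarrow> topspace (nsphere n)"
      using f(3) refl(2) by (auto simp: F_def)
    moreover have "Brouwer_degree2 n (F \<circ> to_quartic ?q) = k"
      using f(4) m2 degree_reflect_0_compose[OF cfh] by (simp add: F_def comp_assoc)
    ultimately show ?thesis by blast
  qed
  then obtain f where f: "\<And>i. i < Suc n \<Longrightarrow> mpoly_fun (Suc n) UNIV (\<lambda>x. f x i)" "continuous_on ?M f"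
    "f \<in> ?M \<rightarrow> topspace (nsphere n)" "Brouwer_degree2 n (f \<circ> to_quartic ?q) = k" by blast
  have "polynomial_map (Suc n) ?M (Suc n) (topspace (nsphere n)) f"
    using f(1,3) by (intro polynomial_mapI nsphere_subset) (auto simp: quartic_sphere_def)
  moreover have "has_Brouwer_degree n (quartic_ball n ?q) ?M (unit_ball n) (topspace (nsphere n)) f k"
    using quartic_degree[OF _ q(1) f(2,3)] f(4) assms(1) by simp
  ultimately show "\<exists>f. polynomial_map (Suc n) ?M (Suc n) (topspace (nsphere n)) f \<and>
                    has_Brouwer_degree n (quartic_ball n ?q) ?M (unit_ball n) (topspace (nsphere n)) f k"
    by blast
qed

end
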